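(* Let $n,k$ be integers with $k\geq 2$ and $n\geq 3k^2$. Then \[ ar(n,\{K_{1,k+1},(k+1)K_2\})=\begin{cases} 4, & \text{if } k=2,\\ k^2-k+2, & \text{if } k \text{ is odd},\\ k^2-\frac{3}{2}k+2, & \text{if } k \text{ is even and } k\geq 4. \end{cases} \]
   Context: All graphs are finite and simple. $K_{1,m}$ denotes the star with $m$ edges, and $mK_2$ denotes a matching with $m$ edges ($m$ pairwise vertex-disjoint edges). An edge-colored graph is rainbow if all its edges have distinct colors. For a positive integer $n$ and a family of graphs $\mathcal{G}$, the anti-Ramsey number $ar(n,\mathcal{G})$ is the minimum number $r$ such that every edge-coloring of the complete graph $K_n$ using exactly $r$ colors contains a rainbow copy of some graph in $\mathcal{G}$. *)

theory Defs
  imports Complex_Main "HOL-Library.Ramsey"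
begin

type_synonym 'a graph = "'a set \<times> 'a set set"

abbreviation verts :: "'a graph \<Rightarrow> 'a set" where "verts \<equiv> fst"
abbreviation edges :: "'a graph \<Rightarrow> 'a set set" where "edges \<equiv> snd"

definition simple_graph :: "'a graph \<Rightarrow> bool" where
  "simple_graph G \<longleftrightarrow> finite (verts G) \<and> edges G \<subseteq> [verts G]\<^bsup>2\<^esup>"

definition subgraph :: "'a graph \<Rightarrow> 'a graph \<Rightarrow> bool" where
  "subgraph H G \<longleftrightarrow>
     simple_graph H \<and> simple_graph G \<and> verts H \<subseteq> verts G \<and> edges H \<subseteq> edges G"

definition graph_iso :: "'a graph \<Rightarrow> 'b graph \<Rightarrow> bool" where
  "graph_iso G H \<longleftrightarrow>
     (\<exists>f. bij_betw f (verts G) (verts H) \<and>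
          (\<forall>u\<in>verts G. \<forall>v\<in>verts G. {u, v} \<in> edges G \<longleftrightarrow> {f u, f v} \<in> edges H))"

definition complete_graph :: "nat \<Rightarrow> nat graph" where
  "complete_graph n = ({..<n}, [{..<n}]\<^bsup>2\<^esup>)"

definition star_graph :: "nat \<Rightarrow> nat graph" where
  "star_graph m = ({..m}, {{0, i} | i. 1 \<le> i \<and> i \<le> m})"

definition matching_graph :: "nat \<Rightarrow> nat graph" where
  "matching_graph m = ({..<2 * m}, {{2 * i, 2 * i + 1} | i. i < m})"

definition rainbow :: "('a set \<Rightarrow> 'c) \<Rightarrow> 'a graph \<Rightarrow> bool" where
  "rainbow c G \<longleftrightarrow> inj_on c (edges G)"

definition has_rainbow_copy :: "('a set \<Rightarrow> 'c) \<Rightarrow> 'a graph \<Rightarrow> 'b graph \<Rightarrow> bool" where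
  "has_rainbow_copy c G H \<longleftrightarrow> (\<exists>S. subgraph S G \<and> graph_iso S H \<and> rainbow c S)"

text \<open>The number of colors is required to be positive: a complete graph with at least one edge
  has no coloring with exactly 0 colors, so that 0 would satisfy the condition vacuously.
  Since \<^term>\<open>complete_graph n\<close> is finite, colors may be taken to be natural numbers, and
  the minimum exists, as the condition holds for every \<^term>\<open>r\<close> exceeding the number of edges.\<close>

definition anti_ramsey :: "nat \<Rightarrow> 'b graph set \<Rightarrow> nat" where
  "anti_ramsey n \<G> =
     (LEAST r. 1 \<le> r \<and>
        (\<forall>c :: nat set \<Rightarrow> nat. card (c ` edges (complete_graph n)) = r \<longrightarrow>
           (\<exists>H\<in>\<G>. has_rainbow_copy c (complete_graph n) H)))"

lemma simple_graph_complete_graph: "simple_graph (complete_graph n)"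
  by (simp add: simple_graph_def complete_graph_def)

lemma simple_graph_star_graph: "simple_graph (star_graph m)"
  by (auto simp: simple_graph_def star_graph_def)

lemma simple_graph_matching_graph: "simple_graph (matching_graph m)"
  by (auto simp: simple_graph_def matching_graph_def)

end

theory Submission
  imports Defs
begin

text \<open>Put \<open>d = k - 1\<close>. Coloring injectively a graph with maximum degree and matching number at most
  \<open>d\<close>, and all other edges with one further color, gives the lower bound; the largest number of edges
  of such a graph is given by the theorem of Chvatal and Hanson.

  For the upper bound, \<open>n \<ge> 3k\<^sup>2\<close> forces a color \<open>c\<^sub>0\<close> that has an edge outside every set of \<open>2k\<close>
  vertices, so every rainbow matching without \<open>c\<^sub>0\<close> can be enlarged. If all vertices see \<open>c\<^sub>0\<close>, the other
  colors form a graph with degrees and matching number at most \<open>d\<close>. Otherwise take a maximal set \<open>Q\<close>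
  of vertices that do not see \<open>c\<^sub>0\<close> and have pairwise distinct colors of large degree. The edges of
  these colors can be added greedily to a matching, so the colors not seen by \<open>Q\<close> have matching number
  at most \<open>d - |Q|\<close>, while \<open>Q\<close> sees at most \<open>d|Q| + 1\<close> colors, as any two of its vertices share one.
  This suffices unless \<open>d \<ge> 3\<close> is odd and all estimates are tight; then a vertex of large degree in a
  color of \<open>Q\<close> is missed by a maximum matching, which makes room for one more edge.\<close>

section \<open>Matchings\<close>

text \<open>Take a graph with one edge for each color other than \<open>c\<^sub>0\<close>. A vertex
  that sees \<open>c\<^sub>0\<close> has degree at most \<open>d\<close> in it, as one of its
  \<open>d + 1\<close> colors is lost; a vertex that misses \<open>c\<^sub>0\<close> may keep all
  \<open>d + 1\<close>. This is the obstacle that \<open>Q\<close> removes: by maximality every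
  vertex missing \<open>c\<^sub>0\<close> sees an abundant color of \<open>Q\<close>, so setting
  these colors aside lowers its degree too. The price is the summand 1 in \<open>d|Q| + 1\<close>.
  For even \<open>d\<close> it is repaid, since each vertex of \<open>Q\<close> lowers the matching
  number and thereby the edge bound by \<open>d + 1\<close>. For odd \<open>d\<close> that bound may
  drop by only \<open>d\<close>, so one color too many remains; for \<open>d = 1\<close> it really
  occurs, which makes \<open>k = 2\<close> exceptional. The condition on \<open>n\<close> serves to
  find \<open>c\<^sub>0\<close>: if each color of a maximum rainbow matching could be blocked by
  \<open>2k\<close> vertices, deleting the matching and the blocking sets would remove at most
  \<open>2k\<^sup>2 + 2k\<close> vertices, and for \<open>k \<ge> 3\<close> an edge would be
  left.\<close>

definition edge_graph :: "'a set set \<Rightarrow> bool" where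
  "edge_graph E \<longleftrightarrow> finite E \<and> (\<forall>e\<in>E. card e = 2)"

definition degree :: "'a set set \<Rightarrow> 'a \<Rightarrow> nat" where
  "degree E v = card {e \<in> E. v \<in> e}"

definition matching_in :: "'a set set \<Rightarrow> 'a set set \<Rightarrow> bool" where
  "matching_in E M \<longleftrightarrow> M \<subseteq> E \<and> pairwise disjnt M"

definition matching_number :: "'a set set \<Rightarrow> nat" where
  "matching_number E = Max (card ` {M. matching_in E M})"

text \<open>On the vertices of \<open>E\<close> this is the set \<open>D(E)\<close> of the
  Gallai--Edmonds decomposition; a point outside \<open>\<Union>E\<close> is missable for trivial
  reasons.\<close>

definition missable :: "'a set set \<Rightarrow> 'a \<Rightarrow> bool" where
  "missable E v \<longleftrightarrow> (\<exists>M. matching_in E M \<and> card M = matching_number E \<and> v \<notin> \<Union>M)"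

lemma edge_graph_subset: "edge_graph E \<Longrightarrow> F \<subseteq> E \<Longrightarrow> edge_graph F"
  unfolding edge_graph_def by (auto intro: finite_subset)

lemma finite_edge: "edge_graph E \<Longrightarrow> e \<in> E \<Longrightarrow> finite e"
  unfolding edge_graph_def by (metis card.infinite zero_neq_numeral)

lemma finite_Union_edges: "edge_graph E \<Longrightarrow> finite (\<Union>E)"
  using finite_edge by (auto simp: edge_graph_def)

lemma edge_graph_edgeE:
  assumes "edge_graph E" "e \<in> E" "x \<in> e"
  obtains y where "e = {x, y}" "x \<noteq> y"
proof -
  have "card e = 2" using assms by (auto simp: edge_graph_def)
  then obtain p q where "e = {p, q}" "p \<noteq> q" by (auto simp: card_2_iff)
  then show ?thesis using that assms(3) by blast
qed

lemma matching_in_subset: "matching_in E M \<Longrightarrow> N \<subseteq> M \<Longrightarrow> matching_in E N"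
  unfolding matching_in_def by (auto intro: pairwise_subset)

lemma matching_in_mono: "matching_in E M \<Longrightarrow> E \<subseteq> F \<Longrightarrow> matching_in F M"
  unfolding matching_in_def by auto

lemma matching_in_insert:
  "matching_in E M \<Longrightarrow> e \<in> E \<Longrightarrow> e \<inter> \<Union>M = {} \<Longrightarrow> matching_in E (insert e M)"
  unfolding matching_in_def by (auto simp: pairwise_insert disjnt_def)

lemma matching_in_unique:
  "matching_in E M \<Longrightarrow> e \<in> M \<Longrightarrow> f \<in> M \<Longrightarrow> x \<in> e \<Longrightarrow> x \<in> f \<Longrightarrow> e = f"
  unfolding matching_in_def pairwise_def disjnt_def by blast

lemma matching_in_finite: "edge_graph E \<Longrightarrow> matching_in E M \<Longrightarrow> finite M"
  unfolding matching_in_def edge_graph_def by (auto intro: finite_subset)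

lemma card_Union_matching:
  assumes "edge_graph E" "matching_in E M"
  shows "card (\<Union>M) = 2 * card M"
proof -
  have "card (\<Union>M) = sum card M"
    using assms finite_edge[OF assms(1)] by (intro card_Union_disjoint) (auto simp: matching_in_def)
  also have "\<dots> = (\<Sum>e\<in>M. 2)"
    using assms by (intro sum.cong) (auto simp: matching_in_def edge_graph_def)
  finally show ?thesis by simp
qed

lemma finite_matchings: "edge_graph E \<Longrightarrow> finite {M. matching_in E M}"
  by (rule finite_subset[of _ "Pow E"]) (auto simp: matching_in_def edge_graph_def)

lemma card_matching_le: "edge_graph E \<Longrightarrow> matching_in E M \<Longrightarrow> card M \<le> matching_number E"
  unfolding matching_number_def by (rule Max_ge) (auto simp: finite_matchings)

lemma maximum_matching_exists:
  assumes "edge_graph E"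
  obtains M where "matching_in E M" "card M = matching_number E"
proof -
  have "matching_number E \<in> card ` {M. matching_in E M}"
    unfolding matching_number_def
  proof (rule Max_in)
    show "card ` {M. matching_in E M} \<noteq> {}" by (auto simp: matching_in_def)
  qed (simp add: finite_matchings[OF assms])
  then show ?thesis using that by auto
qed

lemma matching_number_disjoint_union:
  assumes "edge_graph E" "E1 \<subseteq> E" "E2 \<subseteq> E" "\<Union>E1 \<inter> \<Union>E2 = {}"
  shows "matching_number E1 + matching_number E2 \<le> matching_number E"
proof -
  obtain M1 where M1: "matching_in E1 M1" "card M1 = matching_number E1"
    using maximum_matching_exists[OF edge_graph_subset[OF assms(1,2)]] .
  obtain M2 where M2: "matching_in E2 M2" "card M2 = matching_number E2"
    using maximum_matching_exists[OF edge_graph_subset[OF assms(1,3)]] .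
  have fin: "finite M1" "finite M2"
    using matching_in_finite[OF edge_graph_subset[OF assms(1,2)] M1(1)]
      matching_in_finite[OF edge_graph_subset[OF assms(1,3)] M2(1)] by auto
  have ne: "e \<noteq> {}" if "e \<in> E" for e using that assms(1) by (auto simp: edge_graph_def)
  have dis: "M1 \<inter> M2 = {}"
  proof (rule ccontr)
    assume "M1 \<inter> M2 \<noteq> {}"
    then obtain e where "e \<in> E1" "e \<in> E2" using M1(1) M2(1) by (auto simp: matching_in_def)
    then show False using ne[of e] assms(2,4) by auto
  qed
  have "disjnt e f" if "e \<in> M1" "f \<in> M2" for e f
    using that M1(1) M2(1) assms(4) by (fastforce simp: matching_in_def disjnt_def)
  then have "matching_in E (M1 \<union> M2)"
    using M1(1) M2(1) assms(2,3) by (auto simp: matching_in_def pairwise_def disjnt_sym)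
  then have "card (M1 \<union> M2) \<le> matching_number E" using card_matching_le assms(1) by blast
  then show ?thesis using card_Un_disjoint[OF fin dis] M1 M2 by simp
qed

lemma handshake:
  assumes "edge_graph E"
  shows "(\<Sum>v\<in>\<Union>E. degree E v) = 2 * card E"
proof -
  have "(\<Sum>v\<in>\<Union>E. card {e \<in> E. v \<in> e}) = (\<Sum>e\<in>E. 2)"
  proof (rule sum_multicount_gen)
    show "\<forall>e\<in>E. card {v \<in> \<Union>E. v \<in> e} = 2"
    proof
      fix e assume "e \<in> E"
      then have "{v \<in> \<Union>E. v \<in> e} = e" by auto
      then show "card {v \<in> \<Union>E. v \<in> e} = 2" using \<open>e \<in> E\<close> assms by (simp add: edge_graph_def)
    qed
  qed (use assms finite_Union_edges in \<open>auto simp: edge_graph_def\<close>)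
  then show ?thesis by (simp add: degree_def)
qed

lemma card_edges_le:
  assumes "edge_graph E" "\<And>v. degree E v \<le> d"
  shows "2 * card E \<le> d * card (\<Union>E)"
proof -
  have "(\<Sum>v\<in>\<Union>E. degree E v) \<le> (\<Sum>v\<in>\<Union>E. d)" by (rule sum_mono) (simp add: assms)
  then show ?thesis by (simp add: handshake[OF assms(1)] mult.commute)
qed

lemma degree_mono: "finite F \<Longrightarrow> E \<subseteq> F \<Longrightarrow> degree E v \<le> degree F v"
  unfolding degree_def by (rule card_mono) auto

lemma degree_less_card_Union:
  assumes "edge_graph E"
  shows "degree E v \<le> card (\<Union>E) - 1"
proof (cases "v \<in> \<Union>E")
  case True
  have "{e \<in> E. v \<in> e} \<subseteq> (\<lambda>w. {v, w}) ` (\<Union>E - {v})"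
  proof
    fix e assume "e \<in> {e \<in> E. v \<in> e}"
    then have e: "e \<in> E" "v \<in> e" by auto
    obtain w where "e = {v, w}" "v \<noteq> w" using edge_graph_edgeE[OF assms e] .
    then show "e \<in> (\<lambda>w. {v, w}) ` (\<Union>E - {v})" using e by blast
  qed
  then have "degree E v \<le> card (\<Union>E - {v})"
    unfolding degree_def using finite_Union_edges[OF assms] by (intro surj_card_le) auto
  then show ?thesis using True by simp
next
  case False
  then have "{e \<in> E. v \<in> e} = {}" by auto
  then show ?thesis unfolding degree_def by (metis card.empty le0)
qed

lemma card_delete_vertex:
  assumes "finite E"
  shows "card E = card {e \<in> E. v \<notin> e} + degree E v"
proof -
  have "E = {e \<in> E. v \<notin> e} \<union> {e \<in> E. v \<in> e}" by auto
  then have "card E = card ({e \<in> E. v \<notin> e} \<union> {e \<in> E. v \<in> e})" by simp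
  also have "\<dots> = card {e \<in> E. v \<notin> e} + card {e \<in> E. v \<in> e}"
    by (rule card_Un_disjoint) (use assms in auto)
  finally show ?thesis by (simp add: degree_def)
qed

text \<open>A maximum matching of the rest avoids \<open>v\<close>, so it is not maximum in
  \<open>E\<close>; conversely a maximum matching of \<open>E\<close> has just one edge at
  \<open>v\<close>, and dropping it costs one.\<close>

lemma matching_number_delete_not_missable:
  assumes "edge_graph E" "\<not> missable E v"
  shows "matching_number {e \<in> E. v \<notin> e} + 1 = matching_number E"
proof -
  let ?E = "{e \<in> E. v \<notin> e}"
  have g: "edge_graph ?E" by (rule edge_graph_subset[OF assms(1)]) auto
  obtain N where N: "matching_in ?E N" "card N = matching_number ?E"
    using maximum_matching_exists[OF g] .
  have NE: "matching_in E N" using matching_in_mono[OF N(1), of E] by auto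
  have "v \<notin> \<Union>N" using N(1) by (auto simp: matching_in_def)
  then have "card N < matching_number E"
    using card_matching_le[OF assms(1) NE] assms(2) NE unfolding missable_def
    by (metis le_neq_implies_less)
  moreover have "matching_number E \<le> matching_number ?E + 1"
  proof -
    obtain M where M: "matching_in E M" "card M = matching_number E"
      using maximum_matching_exists[OF assms(1)] .
    then have "v \<in> \<Union>M" using assms(2) by (auto simp: missable_def)
    then obtain e where e: "e \<in> M" "v \<in> e" by auto
    have "v \<notin> f" if "f \<in> M - {e}" for f
      using that matching_in_unique[OF M(1) e(1), of f v] e by blast
    then have "matching_in ?E (M - {e})"
      using M(1) by (auto simp: matching_in_def pairwise_def)
    then have "card (M - {e}) \<le> matching_number ?E" using card_matching_le[OF g] by blast
    then show ?thesis using M e matching_in_finite[OF assms(1)] by (simp add: card_Diff_singleton)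
  qed
  ultimately show ?thesis using N(2) by simp
qed

text \<open>Trading an edge of \<open>N\<close> for an edge of \<open>M\<close> makes the two matchings agree more;
  taking the agreement to be maximal replaces the usual walk along alternating paths.\<close>

lemma matching_exchange:
  assumes E: "edge_graph E" and M: "matching_in E M" and N: "matching_in E N"
    and F: "finite F" "F \<inter> \<Union>N = {}" and U: "finite U" "U \<inter> \<Union>M = {}"
    and less: "2 * card N + card F < 2 * card M + card U"
  obtains N' where "matching_in E N'" "card N' = card N" "F \<inter> \<Union>N' = {}"
    "(\<exists>u\<in>U. u \<notin> \<Union>N') \<or> (\<exists>x y. {x, y} \<in> M \<and> x \<noteq> y \<and> x \<notin> F \<and> x \<notin> \<Union>N' \<and> y \<notin> \<Union>N')"
proof -
  define P where "P N' \<longleftrightarrow> matching_in E N' \<and> card N' = card N \<and> F \<inter> \<Union>N' = {}" for N'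
  have "P N" using N F by (simp add: P_def)
  have finM: "finite M" using matching_in_finite[OF E M] .
  have "\<forall>K. P K \<longrightarrow> card (M \<inter> K) < Suc (card M)"
    using finM by (auto intro!: le_imp_less_Suc card_mono)
  then obtain N' where N': "P N'" and max: "\<And>K. P K \<Longrightarrow> card (M \<inter> K) \<le> card (M \<inter> N')"
    using ex_has_greatest_nat[of P N "\<lambda>K. card (M \<inter> K)" "Suc (card M)"] \<open>P N\<close> by blast
  have mN': "matching_in E N'" and cN': "card N' = card N" and FN': "F \<inter> \<Union>N' = {}"
    using N' by (auto simp: P_def)
  have finN': "finite N'" using matching_in_finite[OF E mN'] .
  show ?thesis
  proof (cases "U \<subseteq> \<Union>N'")
    case False
    then show ?thesis using that mN' cN' FN' by blast
  next
    case True
    have fU: "finite (\<Union>M)" "finite (\<Union>N')"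
      using finite_Union_edges edge_graph_subset[OF E] M mN' by (metis matching_in_def)+
    \<comment> \<open>Otherwise counting vertices would give
      \<open>2|M| \<le> 2|N| - |U| + |F|\<close>, against \<open>less\<close>. So some vertex of
      \<open>M\<close> lies outside \<open>F\<close> and is missed by \<open>N'\<close>.\<close>
    have "\<not> \<Union>M \<subseteq> (\<Union>N' - U) \<union> F"
    proof
      assume "\<Union>M \<subseteq> (\<Union>N' - U) \<union> F"
      then have "card (\<Union>M) \<le> card (\<Union>N' - U) + card F"
        using fU F card_mono[of "(\<Union>N' - U) \<union> F"] card_Un_le[of "\<Union>N' - U" F]
        by (meson finite_Diff finite_UnI le_trans)
      moreover have "card (\<Union>N' - U) = 2 * card N - card U"
        using True U card_Diff_subset[of U "\<Union>N'"] card_Union_matching[OF E mN'] cN' by simp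
      moreover have "card U \<le> 2 * card N"
        using card_mono[OF fU(2) True] card_Union_matching[OF E mN'] cN' by simp
      ultimately show False using less card_Union_matching[OF E M] by simp
    qed
    then obtain x where x: "x \<in> \<Union>M" "x \<notin> F" "x \<notin> \<Union>N'" using U(2) by blast
    then obtain e where e: "e \<in> M" "x \<in> e" by auto
    have "e \<in> E" using e M by (auto simp: matching_in_def)
    then obtain y where y: "e = {x, y}" "x \<noteq> y" using edge_graph_edgeE[OF E _ e(2)] by metis
    have "y \<notin> \<Union>N'"
    proof
      assume "y \<in> \<Union>N'"
      then obtain f where f: "f \<in> N'" "y \<in> f" by auto
      have fM: "f \<notin> M" using matching_in_unique[OF M e(1), of f y] f y x e by auto
      define K where "K = insert e (N' - {f})"
      have yK: "y \<notin> \<Union>(N' - {f})" using matching_in_unique[OF mN' f(1) _ f(2)] by auto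
      have "matching_in E K" unfolding K_def
        by (rule matching_in_insert[OF matching_in_subset[OF mN']])
          (use yK x y e M in \<open>auto simp: matching_in_def\<close>)
      moreover have "card K = card N"
        unfolding K_def using x e f finN' cN' card_Suc_Diff1[OF finN' f(1)]
        by (subst card_insert_disjoint) auto
      moreover have "F \<inter> \<Union>K = {}" unfolding K_def using FN' x y f by auto
      ultimately have "P K" by (simp add: P_def)
      then have "card (M \<inter> K) \<le> card (M \<inter> N')" by (rule max)
      moreover have "M \<inter> K = insert e (M \<inter> N')" unfolding K_def using e fM by auto
      moreover have "e \<notin> M \<inter> N'" using x e by auto
      ultimately show False using finM by simp
    qed
    then show ?thesis using that mN' cN' FN' x e y by blast
  qed
qed

section \<open>Gallai's lemma and the stability of missable vertices\<close>

lemma maximum_matching_covers_edge: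
  assumes "edge_graph E" "matching_in E M" "card M = matching_number E" "{x, y} \<in> E"
  shows "x \<in> \<Union>M \<or> y \<in> \<Union>M"
proof (rule ccontr)
  assume no: "\<not> (x \<in> \<Union>M \<or> y \<in> \<Union>M)"
  then have "matching_in E (insert {x, y} M)" by (intro matching_in_insert assms) auto
  then have "card (insert {x, y} M) \<le> matching_number E" using card_matching_le assms(1) by blast
  then show False using no assms(3) matching_in_finite[OF assms(1,2)] by (subst (asm) card_insert_disjoint) auto
qed

text \<open>If \<open>M\<close> missed both \<open>u\<close> and \<open>v\<close>, an exchange with
  \<open>F = {t}\<close> and \<open>U = {u, v}\<close> would apply, because
  \<open>2\<nu> + 1 < 2\<nu> + 2\<close>. It yields a maximum matching missing \<open>t\<close> and
  one of \<open>u\<close>, \<open>v\<close>; the alternative, an edge with both ends uncovered,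
  contradicts maximality.\<close>

lemma gallai_transitive:
  assumes E: "edge_graph E" and t: "missable E t" "u \<noteq> t" "v \<noteq> t" "u \<noteq> v"
    and ut: "\<And>M. matching_in E M \<Longrightarrow> card M = matching_number E \<Longrightarrow> u \<in> \<Union>M \<or> t \<in> \<Union>M"
    and vt: "\<And>M. matching_in E M \<Longrightarrow> card M = matching_number E \<Longrightarrow> v \<in> \<Union>M \<or> t \<in> \<Union>M"
    and M: "matching_in E M" "card M = matching_number E"
  shows "u \<in> \<Union>M \<or> v \<in> \<Union>M"
proof (rule ccontr)
  assume no: "\<not> (u \<in> \<Union>M \<or> v \<in> \<Union>M)"
  obtain N where N: "matching_in E N" "card N = matching_number E" "t \<notin> \<Union>N"
    using t by (auto simp: missable_def)
  obtain N' where N': "matching_in E N'" "card N' = card N" "{t} \<inter> \<Union>N' = {}"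
    "(\<exists>u\<in>{u, v}. u \<notin> \<Union>N') \<or> (\<exists>x y. {x, y} \<in> M \<and> x \<noteq> y \<and> x \<notin> {t} \<and> x \<notin> \<Union>N' \<and> y \<notin> \<Union>N')"
    by (rule matching_exchange[OF E M(1) N(1), of "{t}" "{u, v}"])
      (use N M no t in \<open>auto simp: card_insert_if\<close>)
  have "\<exists>u\<in>{u, v}. u \<notin> \<Union>N'"
    using N'(4) maximum_matching_covers_edge[OF E N'(1)] N'(2) N(2) M(1)
    by (metis matching_in_def subsetD)
  then show False using ut[OF N'(1)] vt[OF N'(1)] N'(2,3) N(2) by auto
qed

text \<open>This is the stability step of the Gallai--Edmonds theorem. A matching with
  \<open>\<nu> - 1\<close> edges missing \<open>s\<close> and \<open>v\<close> is exchanged towards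
  a maximum one missing \<open>u\<close>, with \<open>F = {s, v}\<close> and \<open>U = {u}\<close>;
  the count is \<open>2(\<nu> - 1) + 2 < 2\<nu> + 1\<close>. If the result misses \<open>u\<close>,
  adding \<open>{s, u}\<close> gives a maximum matching that misses \<open>v\<close>. Otherwise an
  uncovered edge can be added, and as one of its ends is outside \<open>{s, v}\<close>, still
  \<open>s\<close> or \<open>v\<close> is missed.\<close>

lemma missable_delete_stable:
  assumes E: "edge_graph E" and s: "\<not> missable E s" and u: "missable E u" "{s, u} \<in> E"
    and v: "missable {e \<in> E. s \<notin> e} v" "v \<noteq> s"
  shows "missable E v"
proof (rule ccontr)
  assume nv: "\<not> missable E v"
  let ?E = "{e \<in> E. s \<notin> e}"
  note nu = matching_number_delete_not_missable[OF E s]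
  obtain M where M: "matching_in E M" "card M = matching_number E" "u \<notin> \<Union>M"
    using u by (auto simp: missable_def)
  obtain N where N: "matching_in ?E N" "card N = matching_number ?E" "v \<notin> \<Union>N"
    using v by (auto simp: missable_def)
  have NE: "matching_in E N" using matching_in_mono[OF N(1), of E] by auto
  have sN: "s \<notin> \<Union>N" using N(1) by (auto simp: matching_in_def)
  obtain N' where N': "matching_in E N'" "card N' = card N" "{s, v} \<inter> \<Union>N' = {}"
    "(\<exists>u\<in>{u}. u \<notin> \<Union>N') \<or> (\<exists>x y. {x, y} \<in> M \<and> x \<noteq> y \<and> x \<notin> {s, v} \<and> x \<notin> \<Union>N' \<and> y \<notin> \<Union>N')"
    by (rule matching_exchange[OF E M(1) NE, of "{s, v}" "{u}"])
      (use N M sN nu v in \<open>auto simp: card_insert_if\<close>)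
  have uv: "u \<noteq> v" "u \<noteq> s" using u s nv by auto
  have ins: "matching_in E (insert {x, y} N') \<and> card (insert {x, y} N') = matching_number E"
    if "{x, y} \<in> E" "x \<notin> \<Union>N'" "y \<notin> \<Union>N'" for x y
    using matching_in_insert[OF N'(1) that(1)] that matching_in_finite[OF E N'(1)] N'(2) N(2) nu
    by (subst card_insert_disjoint) auto
  from N'(4) show False
  proof
    assume "\<exists>u\<in>{u}. u \<notin> \<Union>N'"
    then have "missable E v"
      unfolding missable_def using ins[of s u] u N'(3) uv v(2)
      by (intro exI[of _ "insert {s, u} N'"]) auto
    then show False using nv by blast
  next
    assume "\<exists>x y. {x, y} \<in> M \<and> x \<noteq> y \<and> x \<notin> {s, v} \<and> x \<notin> \<Union>N' \<and> y \<notin> \<Union>N'"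
    then obtain x y where xy: "{x, y} \<in> M" "x \<notin> {s, v}" "x \<notin> \<Union>N'" "y \<notin> \<Union>N'" by auto
    then have K: "matching_in E (insert {x, y} N')" "card (insert {x, y} N') = matching_number E"
      using ins[of x y] M(1) by (auto simp: matching_in_def)
    have "s \<notin> \<Union>(insert {x, y} N') \<or> v \<notin> \<Union>(insert {x, y} N')"
      using xy N'(3) v(2) by auto
    then show False using K s nv unfolding missable_def by blast
  qed
qed

section \<open>The Chvatal--Hanson bound\<close>

text \<open>The hypotheses are the degree bound and the complete-graph bound for
  \<open>2\<nu> + 1\<close> vertices. If \<open>2\<nu> + 1 \<le> d\<close>, the latter gives
  \<open>d\<nu>\<close>; otherwise, for positive \<open>d\<close>, the quotient in the conclusion is
  at least 1 and the degree bound suffices.\<close>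

lemma chvatal_hanson_near_complete:
  fixes m d \<nu> :: nat
  assumes "2 * m \<le> d * (2 * \<nu> + 1)" "2 * m \<le> 2 * \<nu> * (2 * \<nu> + 1)"
  shows "m \<le> d * \<nu> + (d div 2) * (\<nu> div ((d + 1) div 2))"
proof (cases "d = 0 \<or> \<nu> < (d + 1) div 2")
  case True
  then have "2 * \<nu> + 1 \<le> d \<or> d = 0" by auto
  then show ?thesis
  proof
    assume "2 * \<nu> + 1 \<le> d"
    then have "2 * \<nu> * (2 * \<nu> + 1) \<le> 2 * \<nu> * d" by (rule mult_le_mono2)
    with assms(2) have "m \<le> \<nu> * d" by linarith
    then show ?thesis by (simp add: mult.commute trans_le_add1)
  qed (use assms in simp)
next
  case False
  then have "\<nu> div ((d + 1) div 2) \<ge> 1" by (simp add: Suc_leI div_greater_zero_iff)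
  then have "d div 2 \<le> (d div 2) * (\<nu> div ((d + 1) div 2))" by simp
  moreover have "m \<le> d * \<nu> + d div 2" using assms(1) by (simp add: algebra_simps)
  ultimately show ?thesis by linarith
qed

text \<open>A vertex covered by every maximum matching is deleted.
  Otherwise missing two vertices by a common maximum matching is the complement of an equivalence
  relation that contains adjacency, so the graph either splits or has at most
  \<open>2\<nu> + 1\<close> vertices.\<close>

theorem chvatal_hanson:
  assumes "edge_graph E" "\<And>v. degree E v \<le> d"
  shows "card E \<le> d * matching_number E + (d div 2) * (matching_number E div ((d + 1) div 2))"
  using assms
proof (induction "card E" arbitrary: E rule: less_induct)
  case less
  note E = \<open>edge_graph E\<close>
  have fin: "finite E" using E by (simp add: edge_graph_def)
  define f where "f \<nu> = d * \<nu> + (d div 2) * (\<nu> div ((d + 1) div 2))" for \<nu>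
  have IH: "card F \<le> f (matching_number F)" if "F \<subset> E" for F
    unfolding f_def
  proof (rule less.hyps)
    show "card F < card E" using that fin by (rule psubset_card_mono[rotated])
    show "edge_graph F" using edge_graph_subset[OF E] that by blast
    show "degree F v \<le> d" for v using degree_mono[OF fin, of F v] less.prems(2)[of v] that by auto
  qed
  have "card E \<le> f (matching_number E)"
  proof (cases "\<forall>v\<in>\<Union>E. missable E v")
    case False
    then obtain v where v: "v \<in> \<Union>E" "\<not> missable E v" by auto
    define F where "F = {e \<in> E. v \<notin> e}"
    have "F \<subset> E" using v(1) by (auto simp: F_def)
    then have "card E \<le> f (matching_number F) + d"
      using card_delete_vertex[OF fin, of v] IH[of F] less.prems(2)[of v] by (simp add: F_def)
    moreover have "f (matching_number F) + d \<le> f (matching_number F + 1)"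
      by (auto simp: f_def intro!: mult_le_mono2 div_le_mono)
    ultimately show ?thesis
      using matching_number_delete_not_missable[OF E v(2)] by (simp add: F_def)
  next
    case all: True
    define sim where "sim u v \<longleftrightarrow> u = v \<or>
      (\<forall>M. matching_in E M \<longrightarrow> card M = matching_number E \<longrightarrow> u \<in> \<Union>M \<or> v \<in> \<Union>M)" for u v
    have sym: "sim u v \<Longrightarrow> sim v u" for u v unfolding sim_def by blast
    have trans: "sim u v" if "sim u t" "sim t v" "t \<in> \<Union>E" for u t v
    proof (cases "u = v \<or> u = t \<or> v = t")
      case True
      then show ?thesis using that by (auto simp: sim_def)
    next
      case False
      have "missable E t" using all that by blast
      from gallai_transitive[OF E this, of u v] that False show ?thesis
        unfolding sim_def by metis
    qed
    have adj: "sim x y" if "{x, y} \<in> E" for x y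
      unfolding sim_def using maximum_matching_covers_edge[OF E _ _ that] by blast
    show ?thesis
    proof (cases "E = {}")
      case False
      then obtain e where e: "e \<in> E" by auto
      then have "e \<noteq> {}" using E by (auto simp: edge_graph_def)
      then obtain u where u: "u \<in> \<Union>E" using e by auto
      define A where "A = {v \<in> \<Union>E. sim u v}"
      show ?thesis
      proof (cases "A = \<Union>E")
        case True
        obtain M where M: "matching_in E M" "card M = matching_number E"
          using maximum_matching_exists[OF E] .
        have "v = w" if "v \<in> \<Union>E - \<Union>M" "w \<in> \<Union>E - \<Union>M" for v w
        proof -
          have "sim v w" using trans[of v u w] sym that True u by (auto simp: A_def)
          then show ?thesis using M that by (auto simp: sim_def)
        qed
        then have "\<exists>x. \<Union>E - \<Union>M \<subseteq> {x}" by blast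
        then have "card (\<Union>E - \<Union>M) \<le> 1"
          using card_mono[of "{_}"] by (metis finite.emptyI finite.insertI is_singletonI is_singleton_altdef)
        then have c: "card (\<Union>E) \<le> 2 * matching_number E + 1"
          using diff_card_le_card_Diff[of "\<Union>M" "\<Union>E"] card_Union_matching[OF E M(1)] M
            finite_Union_edges[OF edge_graph_subset[OF E, of M]]
          by (simp add: matching_in_def)
        have "2 * card E \<le> d * (2 * matching_number E + 1)"
          using card_edges_le[OF E less.prems(2)] c by (meson le_trans mult_le_mono2)
        moreover have "2 * card E \<le> 2 * matching_number E * (2 * matching_number E + 1)"
        proof -
          have "degree E v \<le> 2 * matching_number E" for v
            using degree_less_card_Union[OF E, of v] c by simp
          from card_edges_le[OF E this] c show ?thesis by (meson le_trans mult_le_mono2)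
        qed
        ultimately show ?thesis unfolding f_def by (rule chvatal_hanson_near_complete)
      next
        case False
        define E1 where "E1 = {e \<in> E. e \<subseteq> A}"
        define E2 where "E2 = E - E1"
        have closed: "e \<subseteq> A" if ex: "e \<in> E" "x \<in> e" "x \<in> A" for e x
        proof -
          obtain y where y: "e = {x, y}" using edge_graph_edgeE[OF E ex(1,2)] by metis
          then have "sim u y" using adj[of x y] trans[of u x y] ex by (auto simp: A_def)
          then show ?thesis using y ex by (auto simp: A_def)
        qed
        have "u \<in> A" using u by (simp add: A_def sim_def)
        then have "E1 \<noteq> {}" using u closed unfolding E1_def by blast
        then have sub2: "E2 \<subset> E" unfolding E2_def E1_def by blast
        have "\<exists>x. x \<in> \<Union>E \<and> x \<notin> A" using False by (auto simp: A_def)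
        then have sub1: "E1 \<subset> E" unfolding E1_def by blast
        have "\<Union>E1 \<subseteq> A" by (auto simp: E1_def)
        moreover have "\<Union>E2 \<inter> A = {}" using closed unfolding E2_def E1_def by blast
        ultimately have "\<Union>E1 \<inter> \<Union>E2 = {}" by blast
        then have nu: "matching_number E1 + matching_number E2 \<le> matching_number E"
          using matching_number_disjoint_union[OF E] sub1 sub2 by (simp add: less_imp_le)
        have "card E = card E1 + card E2"
          unfolding E2_def using sub1 fin card_mono[OF fin, of E1]
          by (subst card_Diff_subset) (auto intro: finite_subset)
        also have "\<dots> \<le> f (matching_number E1) + f (matching_number E2)"
          using IH[OF sub1] IH[OF sub2] by simp
        also have "\<dots> \<le> f (matching_number E1 + matching_number E2)"
        proof -
          let ?a = "matching_number E1" and ?b = "matching_number E2" and ?m = "(d + 1) div 2"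
          \<comment> \<open>\<open>f\<close> is superadditive because integer quotients are, so the
            bounds for the two parts add up.\<close>
          have "?a div ?m + ?b div ?m \<le> (?a + ?b) div ?m"
            by (simp only: div_add1_eq[of ?a ?b] le_add1)
          then have "(d div 2) * (?a div ?m + ?b div ?m) \<le> (d div 2) * ((?a + ?b) div ?m)"
            by (rule mult_le_mono2)
          then show ?thesis unfolding f_def by (simp only: distrib_left)
        qed
        also have "\<dots> \<le> f (matching_number E)"
          unfolding f_def using nu by (intro add_mono mult_le_mono2 div_le_mono)
        finally show ?thesis .
      qed
    qed simp
  qed
  then show ?case by (simp add: f_def)
qed

text \<open>With \<open>d = 2m\<close> the extra term is
  \<open>m * (\<nu> div m) \<le> \<nu>\<close>. Applied to the even number \<open>d - 1\<close>, the
  bound also shows that for odd \<open>d\<close> more than \<open>d\<nu>\<close> edges force a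
  vertex of degree \<open>d\<close>.\<close>

corollary chvatal_hanson_even:
  assumes "edge_graph E" "\<And>v. degree E v \<le> d" "even d"
  shows "card E \<le> (d + 1) * matching_number E"
proof -
  obtain m where m: "d = 2 * m" using assms(3) by auto
  have "card E \<le> d * matching_number E + m * (matching_number E div m)"
    using chvatal_hanson[OF assms(1,2)] m by simp
  also have "m * (matching_number E div m) \<le> matching_number E" by (rule times_div_less_eq_dividend)
  finally show ?thesis by simp
qed

text \<open>The hypothesis \<open>\<nu> \<le> d\<close> keeps \<open>\<nu>\<close> below twice
  \<open>(d + 1) div 2\<close>, so the extra term \<open>d div 2\<close> counts at most
  once.\<close>

corollary chvatal_hanson_odd:
  assumes "edge_graph E" "\<And>v. degree E v \<le> d" "odd d" "matching_number E \<le> d"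
  shows "card E \<le> d * matching_number E + d div 2"
proof -
  have "matching_number E < 2 * ((d + 1) div 2)" using assms(3,4) by (auto elim!: oddE)
  then have "matching_number E div ((d + 1) div 2) \<le> 1"
    by (metis One_nat_def less_Suc_eq_le less_mult_imp_div_less numeral_2_eq_2)
  then have "(d div 2) * (matching_number E div ((d + 1) div 2)) \<le> (d div 2) * 1"
    by (rule mult_le_mono2)
  then show ?thesis using chvatal_hanson[OF assms(1,2)] by (simp add: le_trans)
qed

text \<open>Vertices that are not missable but adjacent to a missable vertex are deleted one by one, which
  creates no new missable vertices. The missable vertices then span a graph of their own, and a
  graph with even maximum degree \<open>d - 1\<close> has at most \<open>d\<nu>\<close> edges.\<close>

lemma missable_full_degree_vertex:
  assumes "edge_graph E" "\<And>v. degree E v \<le> d" "odd d" "d * matching_number E < card E"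
  obtains z where "missable E z" "d \<le> degree E z" "\<And>e u. e \<in> E \<Longrightarrow> z \<in> e \<Longrightarrow> u \<in> e \<Longrightarrow> missable E u"
proof -
  have "\<exists>z. missable E z \<and> d \<le> degree E z \<and> (\<forall>e\<in>E. z \<in> e \<longrightarrow> (\<forall>u\<in>e. missable E u))"
    using assms
  proof (induction "card E" arbitrary: E rule: less_induct)
    case less
    note E = \<open>edge_graph E\<close>
    have fin: "finite E" using E by (simp add: edge_graph_def)
    show ?case
    proof (cases "\<exists>s u. {s, u} \<in> E \<and> \<not> missable E s \<and> missable E u")
      case True
      then obtain s u where su: "{s, u} \<in> E" "\<not> missable E s" "missable E u" by auto
      define F where "F = {e \<in> E. s \<notin> e}"
      have FE: "F \<subset> E" using su by (auto simp: F_def)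
      have F: "edge_graph F" using edge_graph_subset[OF E] FE by blast
      have nu: "matching_number F + 1 = matching_number E"
        unfolding F_def by (rule matching_number_delete_not_missable[OF E su(2)])
      have cE: "card E \<le> card F + d"
        using card_delete_vertex[OF fin, of s] less.prems(2)[of s] by (simp add: F_def)
      have "d * matching_number F + d < card E" using less.prems(4) nu by (metis Suc_eq_plus1 mult_Suc_right add.commute)
      then have "d * matching_number F < card F" using cE by simp
      moreover have "degree F v \<le> d" for v
        using degree_mono[OF fin, of F v] less.prems(2)[of v] FE by auto
      ultimately obtain z where z: "missable F z" "d \<le> degree F z"
          "\<forall>e\<in>F. z \<in> e \<longrightarrow> (\<forall>u\<in>e. missable F u)"
        using less.hyps[of F] psubset_card_mono[OF fin FE] F less.prems(3) by blast
      have st: "missable E v" if "missable F v" "v \<noteq> s" for v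
        using missable_delete_stable[OF E su(2,3,1)] that by (simp add: F_def)
      have "d > 0" using less.prems(3) by (rule odd_pos)
      then have "{e \<in> F. z \<in> e} \<noteq> {}" using z(2) by (metis card.empty degree_def leD)
      then have zs: "z \<noteq> s" by (auto simp: F_def)
      \<comment> \<open>In \<open>F\<close> the vertex \<open>z\<close> already has \<open>d\<close>
        edges, all that \<open>E\<close> allows, so \<open>z\<close> is not adjacent to
        \<open>s\<close> and keeps its neighbors.\<close>
      have eq: "{e \<in> F. z \<in> e} = {e \<in> E. z \<in> e}"
      proof (rule card_seteq)
        show "card {e \<in> E. z \<in> e} \<le> card {e \<in> F. z \<in> e}"
          using z(2) less.prems(2)[of z] by (simp add: degree_def)
      qed (use fin FE in auto)
      have "missable E v" if "e \<in> E" "z \<in> e" "v \<in> e" for e v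
      proof -
        have "e \<in> F" using eq that by blast
        then show ?thesis using z(3) that st[of v] by (auto simp: F_def)
      qed
      then show ?thesis using st[OF z(1) zs] z(2) eq by (auto simp: degree_def)
    next
      case False
      define E1 where "E1 = {e \<in> E. \<forall>u\<in>e. missable E u}"
      define E2 where "E2 = E - E1"
      have sub: "E1 \<subseteq> E" "E2 \<subseteq> E" by (auto simp: E1_def E2_def)
      have g: "edge_graph E1" "edge_graph E2" using edge_graph_subset[OF E] sub by auto
      have closed: "missable E y" if e: "e \<in> E" "x \<in> e" "y \<in> e" and "missable E x" for e x y
      proof -
        obtain w where "e = {x, w}" using edge_graph_edgeE[OF E e(1,2)] by metis
        then have "{y, x} \<in> E \<or> y = x" using e by (auto simp: insert_commute)
        then show ?thesis using False \<open>missable E x\<close> by blast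
      qed
      have n2: "\<not> missable E x" if "x \<in> \<Union>E2" for x
        using that closed by (auto simp: E2_def E1_def)
      have "\<Union>E1 \<inter> \<Union>E2 = {}" using n2 by (auto simp: E1_def)
      then have nu: "matching_number E1 + matching_number E2 \<le> matching_number E"
        by (rule matching_number_disjoint_union[OF E sub])
      obtain M where M: "matching_in E M" "card M = matching_number E"
        using maximum_matching_exists[OF E] .
      have M2: "matching_in E2 (M \<inter> E2)"
        using M(1) by (auto simp: matching_in_def pairwise_def)
      \<comment> \<open>No vertex of \<open>E2\<close> is missable, so \<open>M\<close> covers it,
        and by an edge of \<open>E2\<close>. Hence \<open>E2\<close> has at most
        \<open>2\<nu>(E2)\<close> vertices and at most \<open>d\<nu>(E2)\<close> edges; the surplus
        over \<open>d\<nu>\<close> lies in \<open>E1\<close>.\<close>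
      have "\<Union>E2 \<subseteq> \<Union>(M \<inter> E2)"
      proof
        fix x assume x: "x \<in> \<Union>E2"
        then have "x \<in> \<Union>M" using n2 M by (auto simp: missable_def)
        then obtain e where e: "e \<in> M" "x \<in> e" by auto
        have "e \<notin> E1" using e n2[OF x] by (auto simp: E1_def)
        then have "e \<in> E2" using e M(1) by (auto simp: E2_def matching_in_def)
        then show "x \<in> \<Union>(M \<inter> E2)" using e by auto
      qed
      then have "card (\<Union>E2) \<le> card (\<Union>(M \<inter> E2))"
        by (rule card_mono[rotated]) (rule finite_Union_edges[OF edge_graph_subset[OF E]], use sub in auto)
      also have "\<dots> \<le> 2 * matching_number E2"
        using card_Union_matching[OF g(2) M2] card_matching_le[OF g(2) M2] by simp
      finally have "2 * card E2 \<le> d * (2 * matching_number E2)"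
        using card_edges_le[OF g(2), of d] degree_mono[OF fin sub(2)] less.prems(2)
        by (meson le_trans mult_le_mono2)
      then have c2: "card E2 \<le> d * matching_number E2" by simp
      have "card E = card E1 + card E2"
        unfolding E2_def using sub fin card_mono[OF fin, of E1]
        by (subst card_Diff_subset) (auto intro: finite_subset)
      moreover have "d * matching_number E1 + d * matching_number E2 \<le> d * matching_number E"
        using nu by (metis distrib_left mult_le_mono2)
      ultimately have big: "d * matching_number E1 < card E1"
        using c2 less.prems(4) by linarith
      have d: "d > 0" "even (d - 1)" using less.prems(3) by (auto elim!: oddE)
      have "\<exists>z. d \<le> degree E1 z"
      proof (rule ccontr)
        assume "\<not> (\<exists>z. d \<le> degree E1 z)"
        then have "degree E1 v \<le> d - 1" for v by (metis Suc_pred' d(1) not_le less_Suc_eq_le)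
        then have "card E1 \<le> (d - 1 + 1) * matching_number E1"
          by (rule chvatal_hanson_even[OF g(1) _ d(2)])
        then show False using big d(1) by simp
      qed
      then obtain z where z: "d \<le> degree E1 z" by auto
      then have "{e \<in> E1. z \<in> e} \<noteq> {}" using d(1) by (metis card.empty degree_def leD)
      then have mz: "missable E z" by (auto simp: E1_def)
      then show ?thesis using closed z degree_mono[OF fin sub(1), of z] by (meson le_trans)
    qed
  qed
  then show ?thesis using that by blast
qed

section \<open>Colorings without large rainbow stars and matchings\<close>

definition seen :: "'a set \<Rightarrow> ('a set \<Rightarrow> 'c) \<Rightarrow> 'a \<Rightarrow> 'c set" where
  "seen V c v = (\<lambda>w. c {v, w}) ` (V - {v})"

definition rainbow_matching :: "'a set \<Rightarrow> ('a set \<Rightarrow> 'c) \<Rightarrow> 'a set set \<Rightarrow> bool" where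
  "rainbow_matching V c M \<longleftrightarrow> matching_in ([V]\<^bsup>2\<^esup>) M \<and> inj_on c M"

text \<open>With \<open>d = k - 1\<close> these are the colorings without a rainbow star or matching
  of \<open>k + 1\<close> edges; \<open>d\<close> counts what is left at a vertex, or in a matching,
  after one distinguished color is set aside.\<close>

locale rainbow_free =
  fixes V :: "'a set" and c :: "'a set \<Rightarrow> 'c" and d :: nat
  assumes finite_V: "finite V"
    and seen_le: "v \<in> V \<Longrightarrow> card (seen V c v) \<le> d + 1"
    and rainbow_matching_le: "rainbow_matching V c M \<Longrightarrow> card M \<le> d + 1"
    and d_pos: "1 \<le> d"
    and many_vertices: "3 * (d + 1)\<^sup>2 \<le> card V"
begin

abbreviation "K \<equiv> [V]\<^bsup>2\<^esup>"

abbreviation "colors \<equiv> c ` K"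

text \<open>The thresholds reflect that a rainbow matching covers at most \<open>2 * (d + 1)\<close> vertices.\<close>

definition abundant :: "'a \<Rightarrow> 'c \<Rightarrow> bool" where
  "abundant v x \<longleftrightarrow> 2 * (d + 1) \<le> card {w \<in> V - {v}. c {v, w} = x}"

definition robust :: "'c \<Rightarrow> bool" where
  "robust x \<longleftrightarrow> (\<forall>X. finite X \<longrightarrow> card X \<le> 2 * (d + 1) \<longrightarrow> (\<exists>e\<in>K. c e = x \<and> e \<inter> X = {}))"

lemma edge_graph_K: "edge_graph K"
  using finite_V by (auto simp: edge_graph_def nsets_def)

lemma finite_colors: "finite colors"
  using edge_graph_K by (simp add: edge_graph_def)

lemma edge_in_K: "v \<in> V \<Longrightarrow> w \<in> V \<Longrightarrow> v \<noteq> w \<Longrightarrow> {v, w} \<in> K"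
  by (auto simp: nsets_def)

lemma finite_seen: "finite (seen V c v)"
  using finite_V by (simp add: seen_def)

lemma seen_edge: "v \<in> V \<Longrightarrow> w \<in> V \<Longrightarrow> v \<noteq> w \<Longrightarrow> c {v, w} \<in> seen V c v"
  by (auto simp: seen_def)

lemma seen_edge': "v \<in> V \<Longrightarrow> w \<in> V \<Longrightarrow> v \<noteq> w \<Longrightarrow> c {v, w} \<in> seen V c w"
  using seen_edge[of w v] by (simp add: insert_commute)

lemma seen_subset_colors: "v \<in> V \<Longrightarrow> seen V c v \<subseteq> colors"
  using edge_in_K by (auto simp: seen_def)

lemma color_seen:
  assumes "e \<in> K" "v \<in> e"
  shows "c e \<in> seen V c v"
proof -
  obtain w where "e = {v, w}" "v \<noteq> w" using edge_graph_edgeE[OF edge_graph_K assms] .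
  then show ?thesis using seen_edge[of v w] assms by (auto simp: nsets_def)
qed

lemma K_vertex: "e \<in> K \<Longrightarrow> v \<in> e \<Longrightarrow> v \<in> V"
  by (auto simp: nsets_def)

lemma abundant_seen:
  assumes "abundant v x"
  shows "x \<in> seen V c v"
proof -
  have "card {w \<in> V - {v}. c {v, w} = x} > 0" 
    using assms unfolding abundant_def by (rule less_le_trans[rotated]) simp
  then have "{w \<in> V - {v}. c {v, w} = x} \<noteq> {}" by (metis card_gt_0_iff)
  then show ?thesis by (auto simp: seen_def)
qed

text \<open>Pigeonhole: if each of the at most \<open>d + 1\<close> colors at \<open>v\<close> had
  fewer than \<open>2(d + 1)\<close> edges there, \<open>V\<close> would have at most
  \<open>2(d + 1)\<^sup>2 + 1\<close> vertices.\<close>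

lemma abundant_exists:
  assumes "v \<in> V"
  shows "\<exists>x. abundant v x"
proof (rule ccontr)
  assume no: "\<not> (\<exists>x. abundant v x)"
  let ?S = "\<lambda>x. {w \<in> V - {v}. c {v, w} = x}"
  have "V - {v} \<subseteq> (\<Union>x\<in>seen V c v. ?S x)" by (auto simp: seen_def)
  then have "card (V - {v}) \<le> card (\<Union>x\<in>seen V c v. ?S x)"
    by (rule card_mono[rotated]) (use finite_V finite_seen in auto)
  also have "\<dots> \<le> (\<Sum>x\<in>seen V c v. card (?S x))"
    by (rule card_UN_le[OF finite_seen])
  also have "\<dots> \<le> (\<Sum>x\<in>seen V c v. 2 * (d + 1))"
    by (rule sum_mono) (use no in \<open>simp add: abundant_def not_le less_imp_le\<close>)
  also have "\<dots> = card (seen V c v) * (2 * (d + 1))" by (simp only: sum_constant of_nat_id)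
  also have "\<dots> \<le> (d + 1) * (2 * (d + 1))" using seen_le[OF assms] by (rule mult_le_mono1)
  finally have "card V \<le> 2 * (d + 1)\<^sup>2 + 1"
    using assms finite_V by (simp add: power2_eq_square)
  moreover have "2 \<le> (d + 1)\<^sup>2" using d_pos by (simp add: power2_eq_square)
  ultimately show False using many_vertices by linarith
qed

section \<open>Extending rainbow matchings by abundant and robust colors\<close>

lemma rainbow_matching_insert:
  assumes "rainbow_matching V c N" "e \<in> K" "e \<inter> \<Union>N = {}" "c e \<notin> c ` N"
  shows "rainbow_matching V c (insert e N)" "card (insert e N) = card N + 1"
proof -
  show "rainbow_matching V c (insert e N)"
    using assms matching_in_insert by (auto simp: rainbow_matching_def)
  have "finite N" using assms matching_in_finite[OF edge_graph_K] by (simp add: rainbow_matching_def)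
  moreover have "e \<notin> N" using assms(4) by auto
  ultimately show "card (insert e N) = card N + 1" by simp
qed

text \<open>Greedy choice: the partner of \<open>y\<close> must avoid the current matching and the
  rest of \<open>Q\<close>, whose vertices need edges of their own. As at most \<open>d + 1\<close>
  edges are aimed at, these are fewer than \<open>2(d + 1)\<close> vertices, and abundance leaves a
  choice.\<close>

lemma extend_rainbow_matching:
  assumes "finite Q" "rainbow_matching V c N" "Q \<subseteq> V" "Q \<inter> \<Union>N = {}" "inj_on a Q"
    "a ` Q \<inter> c ` N = {}" "\<And>y. y \<in> Q \<Longrightarrow> abundant y (a y)" "card N + card Q \<le> d + 1"
  shows "\<exists>N'. rainbow_matching V c N' \<and> card N' = card N + card Q \<and> c ` N' = c ` N \<union> a ` Q"
  using assms
proof (induction Q arbitrary: N rule: finite_induct)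
  case empty
  then show ?case by auto
next
  case (insert y Q)
  let ?W = "{w \<in> V - {y}. c {y, w} = a y}"
  have mN: "matching_in K N" using insert.prems(1) by (simp add: rainbow_matching_def)
  have "card (\<Union>N \<union> Q) \<le> 2 * card N + card Q"
    using card_Un_le[of "\<Union>N" Q] card_Union_matching[OF edge_graph_K mN] by simp
  also have "\<dots> < 2 * (d + 1)" using insert.prems(7) insert.hyps by simp
  also have "\<dots> \<le> card ?W" using insert.prems(6) by (simp add: abundant_def)
  finally have less: "card (\<Union>N \<union> Q) < card ?W" .
  have "finite (\<Union>N)"
    using finite_Union_edges edge_graph_subset[OF edge_graph_K] mN by (metis matching_in_def)
  then have "\<not> ?W \<subseteq> \<Union>N \<union> Q"
    using less insert.hyps(1) card_mono[of "\<Union>N \<union> Q" ?W] by (metis finite_UnI not_le)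
  then obtain w where w: "w \<in> V" "w \<noteq> y" "c {y, w} = a y" "w \<notin> \<Union>N" "w \<notin> Q" by auto
  let ?N = "insert {y, w} N"
  have yw: "{y, w} \<in> K" using w insert.prems(2) by (intro edge_in_K) auto
  have ins: "rainbow_matching V c ?N" "card ?N = card N + 1"
    using rainbow_matching_insert[OF insert.prems(1) yw] w insert.prems(3,5) by auto
  have "\<exists>N'. rainbow_matching V c N' \<and> card N' = card ?N + card Q \<and> c ` N' = c ` ?N \<union> a ` Q"
  proof (rule insert.IH)
    show "a ` Q \<inter> c ` ?N = {}"
      using insert.prems(4,5) insert.hyps(2) w(3) by (auto simp: inj_on_def)
    show "inj_on a Q" using insert.prems(4) by (rule inj_on_subset) auto
    show "card ?N + card Q \<le> d + 1" using insert.prems(7) ins(2) insert.hyps by simp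
  qed (use ins insert.prems w insert.hyps in auto)
  then show ?case using ins(2) w(3) insert.hyps by auto
qed

lemma robust_system_bound:
  assumes x: "robust x" "x \<notin> c ` N" "x \<notin> a ` Q"
    and N: "rainbow_matching V c N"
    and Q: "Q \<subseteq> V" "Q \<inter> \<Union>N = {}" "inj_on a Q" "a ` Q \<inter> c ` N = {}"
    and ab: "\<And>y. y \<in> Q \<Longrightarrow> abundant y (a y)"
  shows "card N + card Q \<le> d"
proof (rule ccontr)
  assume big: "\<not> card N + card Q \<le> d"
  have finQ: "finite Q" using Q(1) finite_V by (rule finite_subset)
  have "card N \<le> d + 1" using rainbow_matching_le[OF N] .
  \<comment> \<open>Only as many vertices as give exactly \<open>d + 1\<close> edges: the matching
    then covers \<open>2(d + 1)\<close> vertices, the largest number that robustness tolerates, and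
    an edge of color \<open>x\<close> makes it too large.\<close>
  then obtain P where P: "P \<subseteq> Q" "card P = d + 1 - card N"
    using big by (metis add.commute le_diff_conv not_less_eq_eq obtain_subset_with_card_n Suc_eq_plus1)
  have "\<exists>N'. rainbow_matching V c N' \<and> card N' = card N + card P \<and> c ` N' = c ` N \<union> a ` P"
  proof (rule extend_rainbow_matching)
    show "finite P" using P(1) finQ by (rule finite_subset)
    show "inj_on a P" using Q(3) P(1) by (rule inj_on_subset)
    show "a ` P \<inter> c ` N = {}" using Q(4) P(1) by blast
  qed (use P Q ab N \<open>card N \<le> d + 1\<close> in auto)
  then obtain N' where N': "rainbow_matching V c N'" "card N' = d + 1" "c ` N' = c ` N \<union> a ` P"
    using P(2) \<open>card N \<le> d + 1\<close> by auto
  have mN': "matching_in K N'" using N'(1) by (simp add: rainbow_matching_def)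
  then have "finite (\<Union>N')"
    using finite_Union_edges edge_graph_subset[OF edge_graph_K] by (metis matching_in_def)
  moreover have "card (\<Union>N') \<le> 2 * (d + 1)"
    using card_Union_matching[OF edge_graph_K mN'] N'(2) by simp
  ultimately obtain e where e: "e \<in> K" "c e = x" "e \<inter> \<Union>N' = {}"
    using x(1) unfolding robust_def by blast
  have "x \<notin> c ` N'" using x P(1) N'(3) by auto
  then show False
    using rainbow_matching_insert[OF N'(1) e(1,3)] e(2) N'(2) rainbow_matching_le by fastforce
qed

text \<open>One edge per color turns a set of colors into a graph: its matchings are rainbow, and
  its degrees count distinct colors seen at a vertex.\<close>

lemma representatives_exist:
  assumes "A \<subseteq> colors"
  obtains E where "E \<subseteq> K" "c ` E = A" "inj_on c E"
  using assms subset_image_inj[of A c K] by metis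

lemma degree_representatives:
  assumes "E \<subseteq> K" "inj_on c E"
  shows "degree E v \<le> card (seen V c v \<inter> c ` E)"
  unfolding degree_def
proof (rule card_inj_on_le)
  show "inj_on c {e \<in> E. v \<in> e}" using assms(2) by (rule inj_on_subset) auto
  show "c ` {e \<in> E. v \<in> e} \<subseteq> seen V c v \<inter> c ` E" using assms(1) color_seen by blast
qed (simp add: finite_seen)

lemma seen_Union_le:
  assumes "finite R" "R \<subseteq> V"
  shows "card (\<Union>y\<in>R. seen V c y) \<le> d * card R + 1"
  using assms
proof (induction R rule: finite_induct)
  case (insert y R)
  let ?U = "\<Union>y\<in>R. seen V c y"
  have fin: "finite ?U" using insert.hyps finite_seen by blast
  show ?case
  proof (cases "R = {}")
    case True
    then show ?thesis using seen_le[of y] insert.prems by simp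
  next
    case False
    then obtain z where z: "z \<in> R" by auto
    then have "c {y, z} \<in> ?U" "c {y, z} \<in> seen V c y"
      using seen_edge[of y z] seen_edge'[of y z] insert.prems insert.hyps by auto
    then have "card (seen V c y - ?U) \<le> card (seen V c y - {c {y, z}})"
      by (intro card_mono) (auto simp: finite_seen)
    also have "\<dots> \<le> d"
      using \<open>c {y, z} \<in> seen V c y\<close> seen_le[of y] insert.prems finite_seen by simp
    finally have "card (?U \<union> (seen V c y - ?U)) \<le> d * card R + 1 + d"
      using card_Un_le[of ?U "seen V c y - ?U"] insert.IH insert.prems by simp
    moreover have "(\<Union>y\<in>insert y R. seen V c y) = ?U \<union> (seen V c y - ?U)" by auto
    ultimately show ?thesis using insert.hyps by simp
  qed
qed simp

text \<open>Of the at most \<open>d + 1\<close> colors at \<open>z\<close>, edges of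
  \<open>E\<close> take \<open>d\<close>. Any two colors found at \<open>z\<close> and not
  represented in \<open>E\<close> must therefore coincide, which is how colors are identified in the
  odd case.\<close>

lemma full_degree_unique_color:
  assumes "E \<subseteq> K" "inj_on c E" "d \<le> degree E z"
  shows "z \<in> V" "\<And>x y. x \<in> seen V c z - c ` E \<Longrightarrow> y \<in> seen V c z - c ` E \<Longrightarrow> x = y"
proof -
  have "card {e \<in> E. z \<in> e} > 0" 
    using assms(3) unfolding degree_def by (rule less_le_trans[rotated]) (use d_pos in simp)
  then have "{e \<in> E. z \<in> e} \<noteq> {}" by (metis card_gt_0_iff)
  then show z: "z \<in> V" using assms(1) K_vertex by blast
  have "card (seen V c z - c ` E) + card (seen V c z \<inter> c ` E) = card (seen V c z)"
    using card_Un_disjoint[of "seen V c z - c ` E" "seen V c z \<inter> c ` E"] finite_seen[of z]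
    by (simp add: Un_Diff_Int Int_Diff disjoint_iff)
  then have "card (seen V c z - c ` E) \<le> Suc 0"
    using degree_representatives[OF assms(1,2), of z] assms(3) seen_le[OF z] by simp
  then show "x = y" if "x \<in> seen V c z - c ` E" "y \<in> seen V c z - c ` E" for x y
    using that card_le_Suc0_iff_eq[of "seen V c z - c ` E"] finite_seen by blast
qed

end

text \<open>\<open>saturated\<close> is what the maximality of \<open>Q\<close> provides: a vertex
  missing \<open>c0\<close>, none of whose abundant colors has the form \<open>a y\<close>, could be
  added to \<open>Q\<close>.\<close>

locale color_system = rainbow_free +
  fixes c0 :: 'b and Q :: "'a set" and a :: "'a \<Rightarrow> 'b"
  assumes c0: "robust c0"
    and Q: "Q \<subseteq> V" "\<And>y. y \<in> Q \<Longrightarrow> c0 \<notin> seen V c y"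
    and inj_a: "inj_on a Q"
    and abundant_a: "\<And>y. y \<in> Q \<Longrightarrow> abundant y (a y)"
    and saturated: "\<And>v. v \<in> V \<Longrightarrow> c0 \<notin> seen V c v \<Longrightarrow> \<exists>y\<in>Q. abundant v (a y)"

begin

section \<open>Counting colors relative to a saturated system\<close>

lemma finite_Q: "finite Q"
  using Q(1) finite_V by (rule finite_subset)

lemma abundant_color_seen: "y \<in> Q \<Longrightarrow> a y \<in> seen V c y"
  using abundant_seen abundant_a by blast

lemma c0_not_abundant: "c0 \<notin> a ` Q"
  using abundant_color_seen Q(2) by auto

lemma c0_color: "c0 \<in> colors"
  using c0 unfolding robust_def by (metis card.empty finite.emptyI image_eqI le0)

text \<open>Every vertex sees a color that \<open>E\<close> does not use: \<open>c0\<close> or, by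
  saturation, some \<open>a y\<close>. So at most \<open>d\<close> of its \<open>d + 1\<close>
  colors are left.\<close>

lemma degree_le:
  assumes "E \<subseteq> K" "inj_on c E" "c0 \<notin> c ` E" "a ` Q \<inter> c ` E = {}"
  shows "degree E v \<le> d"
proof (cases "v \<in> V")
  case True
  have "\<exists>x. x \<in> seen V c v \<and> x \<notin> c ` E"
  proof (cases "c0 \<in> seen V c v")
    case False
    then obtain y where "y \<in> Q" "abundant v (a y)" using saturated True by blast
    then show ?thesis using abundant_seen assms(4) by blast
  qed (use assms(3) in blast)
  then have "seen V c v \<inter> c ` E \<subset> seen V c v" by blast
  then have "card (seen V c v \<inter> c ` E) < card (seen V c v)"
    by (rule psubset_card_mono[OF finite_seen])
  then show ?thesis using degree_representatives[OF assms(1,2), of v] seen_le[OF True] by linarith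
next
  case False
  then have "{e \<in> E. v \<in> e} = {}" using assms(1) K_vertex by blast
  then show ?thesis unfolding degree_def by (metis card.empty le0)
qed

lemma card_colors:
  assumes "L \<subseteq> colors" "c0 \<notin> L"
  shows "card colors = 1 + card L + card (colors - {c0} - L)"
proof -
  have "card (insert c0 L) = card L + 1"
    using assms finite_subset[OF assms(1) finite_colors] by simp
  moreover have "card (colors - insert c0 L) = card colors - card (insert c0 L)"
    by (rule card_Diff_subset) (use assms c0_color finite_subset[OF assms(1) finite_colors] in auto)
  moreover have "card (insert c0 L) \<le> card colors"
    by (rule card_mono[OF finite_colors]) (use assms c0_color in auto)
  moreover have "colors - {c0} - L = colors - insert c0 L" by blast
  ultimately show ?thesis by simp
qed

lemma matching_number_le:
  assumes E: "E \<subseteq> K" "inj_on c E" "c0 \<notin> c ` E"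
    and R: "R \<subseteq> Q" "\<And>y. y \<in> R \<Longrightarrow> seen V c y \<inter> c ` E = {}"
  shows "matching_number E + card R \<le> d"
proof -
  obtain N where N: "matching_in E N" "card N = matching_number E"
    using maximum_matching_exists[OF edge_graph_subset[OF edge_graph_K E(1)]] .
  have NE: "N \<subseteq> E" using N(1) by (simp add: matching_in_def)
  have "card N + card R \<le> d"
  proof (rule robust_system_bound[OF c0])
    show "c0 \<notin> c ` N" using E(3) NE by auto
    show "c0 \<notin> a ` R" using c0_not_abundant R(1) by auto
    show "rainbow_matching V c N"
      using matching_in_mono[OF N(1) E(1)] inj_on_subset[OF E(2) NE]
      by (simp add: rainbow_matching_def)
    show "R \<subseteq> V" using R(1) Q(1) by auto
    show "R \<inter> \<Union>N = {}"
    proof (rule ccontr)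
      assume "R \<inter> \<Union>N \<noteq> {}"
      then obtain y e where "y \<in> R" "e \<in> N" "y \<in> e" by auto
      then show False using color_seen[of e y] R(2)[of y] NE E(1) by blast
    qed
    show "inj_on a R" using inj_a R(1) by (rule inj_on_subset)
    show "a ` R \<inter> c ` N = {}"
      using abundant_color_seen R NE by blast
    show "abundant y (a y)" if "y \<in> R" for y using abundant_a R(1) that by blast
  qed
  then show ?thesis using N(2) by simp
qed

lemma outside_system_graph_exists:
  obtains E where "E \<subseteq> K" "c ` E = colors - {c0} - (\<Union>y\<in>Q. seen V c y)" "inj_on c E"
    "edge_graph E" "\<And>v. degree E v \<le> d" "matching_number E + card Q \<le> d"
    "d * matching_number E + d * card Q \<le> d * d"
    "card colors = 1 + card (\<Union>y\<in>Q. seen V c y) + card E"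
proof -
  define L where "L = (\<Union>y\<in>Q. seen V c y)"
  have L: "L \<subseteq> colors" "c0 \<notin> L"
    using seen_subset_colors Q by (auto simp: L_def)
  obtain E where E: "E \<subseteq> K" "c ` E = colors - {c0} - L" "inj_on c E"
    by (rule representatives_exist[of "colors - {c0} - L"]) auto
  have gE: "edge_graph E" using edge_graph_subset[OF edge_graph_K E(1)] .
  have seenL: "seen V c y \<subseteq> L" if "y \<in> Q" for y using that by (auto simp: L_def)
  have aL: "a ` Q \<subseteq> L" using abundant_color_seen seenL by blast
  have degE: "degree E v \<le> d" for v
    by (rule degree_le[OF E(1,3)]) (use E(2) aL in blast)+
  have nuE: "matching_number E + card Q \<le> d"
    by (rule matching_number_le[OF E(1,3) _ order_refl]) (use E(2) seenL in blast)+
  then have nuE': "d * matching_number E + d * card Q \<le> d * d"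
    by (metis distrib_left mult_le_mono2)
  have "card colors = 1 + card L + card E"
    using card_colors[OF L] card_image[OF E(3)] E(2) by simp
  then show ?thesis using that E gE degE nuE nuE' unfolding L_def by blast
qed

text \<open>In the remaining case the vertices of \<open>Q\<close> share a single color \<open>b = a y\<^sub>1\<close>, and the
  colors outside \<open>c0\<close>, \<open>b\<close> and those at \<open>Q - {y\<^sub>1}\<close> attain the Chvatal--Hanson bound. Then some
  vertex with abundant color \<open>b\<close> is missed by a maximum matching of these colors, and the matching
  extends to one with \<open>d + 2\<close> colors.\<close>

lemma odd_case:
  assumes d: "odd d" "3 \<le> d" and ne: "Q \<noteq> {}"
  shows "card colors \<le> d * d + d div 2 + 1"
proof (rule ccontr)
  assume "\<not> card colors \<le> d * d + d div 2 + 1"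
  then have big: "d * d + d div 2 + 2 \<le> card colors" by simp
  have half: "1 \<le> d div 2" using d by auto
  define L where "L = (\<Union>y\<in>Q. seen V c y)"
  obtain E where E: "E \<subseteq> K" "c ` E = colors - {c0} - L" "inj_on c E"
    and gE: "edge_graph E" and degE: "\<And>v. degree E v \<le> d"
    and nuE: "matching_number E + card Q \<le> d"
    and nuE': "d * matching_number E + d * card Q \<le> d * d"
    and total: "card colors = 1 + card L + card E"
    using outside_system_graph_exists unfolding L_def by metis
  have cardL: "card L \<le> d * card Q + 1" unfolding L_def by (rule seen_Union_le[OF finite_Q Q(1)])
  have seenL: "seen V c y \<subseteq> L" if "y \<in> Q" for y using that by (auto simp: L_def)
  have moreE: "d * matching_number E < card E" using total big cardL nuE' half by linarith
  have "\<exists>z. d \<le> degree E z"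
  proof (rule ccontr)
    assume no: "\<not> (\<exists>z. d \<le> degree E z)"
    have "degree E v \<le> d - 1" for v
    proof -
      have "degree E v < d" using no by (meson not_le)
      then show ?thesis by linarith
    qed
    moreover have "even (d - 1)" using d by auto
    ultimately have "card E \<le> (d - 1 + 1) * matching_number E"
      using chvatal_hanson_even[OF gE] by blast
    then show False using moreE d by simp
  qed
  then obtain z where z: "d \<le> degree E z" by auto
  note zV = full_degree_unique_color(1)[OF E(1,3) z]
  note z1 = full_degree_unique_color(2)[OF E(1,3) z]
  have zQ: "z \<notin> Q"
  proof
    assume "z \<in> Q"
    then have "seen V c z \<inter> c ` E = {}" using seenL E(2) by auto
    then show False using degree_representatives[OF E(1,3), of z] z d by simp
  qed
  have zy: "c {z, y} \<in> seen V c z - c ` E" "c {z, y} \<in> seen V c y" if "y \<in> Q" for y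
  proof -
    have "y \<in> V" "z \<noteq> y" using that Q(1) zQ by auto
    then show "c {z, y} \<in> seen V c y" by (rule seen_edge'[OF zV])
    then show "c {z, y} \<in> seen V c z - c ` E"
      using seen_edge[OF zV \<open>y \<in> V\<close> \<open>z \<noteq> y\<close>] seenL[OF that] E(2) by auto
  qed
  have "c0 \<notin> seen V c z"
  proof
    assume "c0 \<in> seen V c z"
    then have "c0 \<in> seen V c z - c ` E" using E(2) by auto
    moreover obtain y where "y \<in> Q" using ne by auto
    ultimately show False using z1 zy Q(2) by metis
  qed
  then obtain y1 where y1: "y1 \<in> Q" "abundant z (a y1)" using saturated[OF zV] by auto
  define b where "b = a y1"
  have "b \<in> seen V c z - c ` E"
    using abundant_seen[OF y1(2)] abundant_color_seen[OF y1(1)] seenL[OF y1(1)] E(2)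
    by (auto simp: b_def)
  \<comment> \<open>The edges from \<open>z\<close> to \<open>Q\<close> have colors outside
    \<open>E\<close>, and so is \<open>b\<close>. As \<open>z\<close> sees only one such color, all
    these edges have color \<open>b\<close>.\<close>
  then have b_all: "b \<in> seen V c y" if "y \<in> Q" for y using z1 zy that by metis
  have "card E \<le> d * matching_number E + d div 2"
    by (rule chvatal_hanson_odd[OF gE degE d(1)]) (use nuE in simp)
  \<comment> \<open>No slack is left: \<open>E\<close> attains its largest size, and
    \<open>Q\<close> sees the full \<open>d|Q| + 1\<close> colors.\<close>
  then have cardL': "d * card Q + 1 \<le> card L" using total big nuE' by linarith

  define R where "R = Q - {y1}"
  have R: "R \<subseteq> Q" "finite R" "R \<subseteq> V" using finite_Q Q(1) by (auto simp: R_def)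
  have cardR: "card Q = card R + 1"
    using y1(1) finite_Q card_Suc_Diff1[of Q y1] by (simp add: R_def)
  \<comment> \<open>\<open>y1\<close> is released: of its colors only \<open>b\<close> and those
    seen by \<open>R\<close> stay set aside. Unless \<open>R\<close> is empty it sees
    \<open>b\<close>, so the bound \<open>d|R| + 1\<close> persists.\<close>
  define L2 where "L2 = insert b (\<Union>y\<in>R. seen V c y)"
  have "L2 \<subseteq> L" using b_all y1(1) R(1) by (auto simp: L2_def L_def)
  moreover have "L \<subseteq> colors" "c0 \<notin> L" using seen_subset_colors Q unfolding L_def by blast+
  ultimately have L2: "L2 \<subseteq> colors" "c0 \<notin> L2" by auto
  have cardL2: "card L2 \<le> d * card R + 1"
  proof (cases "R = {}")
    case False
    then have "b \<in> (\<Union>y\<in>R. seen V c y)" using b_all R(1) by auto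
    then have "L2 = (\<Union>y\<in>R. seen V c y)" by (auto simp: L2_def)
    then show ?thesis using seen_Union_le[OF R(2,3)] by simp
  qed (simp add: L2_def)
  define A where "A = colors - {c0} - L2"
  \<comment> \<open>Colors seen by \<open>y1\<close> are represented by edges at \<open>y1\<close>.
    An edge of \<open>G\<close> avoiding \<open>y1\<close> is then in \<open>E2\<close> and has a
    color that \<open>y1\<close> does not see.\<close>
  obtain E1 where E1: "E1 \<subseteq> {e \<in> K. y1 \<in> e}" "c ` E1 = A \<inter> seen V c y1" "inj_on c E1"
  proof -
    have "{y1, w} \<in> {e \<in> K. y1 \<in> e}" if "w \<in> V - {y1}" for w
      using edge_in_K[of y1 w] y1(1) Q(1) that by auto
    then have "seen V c y1 \<subseteq> c ` {e \<in> K. y1 \<in> e}" unfolding seen_def by blast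
    then have "A \<inter> seen V c y1 \<subseteq> c ` {e \<in> K. y1 \<in> e}" by blast
    then show ?thesis using that unfolding subset_image_inj by metis
  qed
  obtain E2 where E2: "E2 \<subseteq> K" "c ` E2 = A - seen V c y1" "inj_on c E2"
    by (rule representatives_exist[of "A - seen V c y1"]) (auto simp: A_def)
  define G where "G = E1 \<union> E2"
  have G: "G \<subseteq> K" "c ` G = A" using E1 E2 by (auto simp: G_def image_Un)
  have injG: "inj_on c G"
    unfolding G_def inj_on_Un using E1 E2 by blast
  have gG: "edge_graph G" using edge_graph_subset[OF edge_graph_K G(1)] .
  have c0G: "c0 \<notin> c ` G" using G(2) by (auto simp: A_def)
  have aG: "a ` Q \<inter> c ` G = {}"
    using abundant_color_seen by (auto simp: G(2) A_def L2_def R_def b_def)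
  have RG: "seen V c y \<inter> c ` G = {}" if "y \<in> R" for y
    using that by (auto simp: G(2) A_def L2_def)
  have degG: "degree G v \<le> d" for v by (rule degree_le[OF G(1) injG c0G aG])
  have cardG: "card colors = 1 + card L2 + card G"
    using card_colors[OF L2] card_image[OF injG] G(2) by (simp add: A_def)
  have nuG: "matching_number G + card R \<le> d"
    by (rule matching_number_le[OF G(1) injG c0G R(1) RG])
  then have nuG': "d * matching_number G + d * card R \<le> d * d"
    by (metis distrib_left mult_le_mono2)
  have moreG: "d * matching_number G < card G" using cardG big cardL2 nuG' half by linarith
  have "card G \<le> d * matching_number G + d div 2"
    by (rule chvatal_hanson_odd[OF gG degG d(1)]) (use nuG in simp)
  then have "d * d \<le> d * matching_number G + d * card R" using cardG big cardL2 by linarith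
  then have "d * d \<le> d * (matching_number G + card R)" by (simp add: distrib_left)
  then have tight: "d \<le> matching_number G + card R" using d by simp

  \<comment> \<open>A maximum matching of \<open>G\<close> that missed \<open>v\<close> would leave
    \<open>v\<close> free for an edge of color \<open>b\<close>, besides the edges in the abundant
    colors of \<open>R\<close>: \<open>d + 1\<close> edges without \<open>c0\<close>, one more than
    possible. In particular \<open>y1\<close> is not missable.\<close>
  have not_missed: "\<not> missable G v" if v: "abundant v b" "v \<in> V" "v \<notin> R" "c0 \<notin> seen V c v" for v
  proof
    assume "missable G v"
    then obtain N where N: "matching_in G N" "card N = matching_number G" "v \<notin> \<Union>N"
      by (auto simp: missable_def)
    have NG: "N \<subseteq> G" using N(1) by (simp add: matching_in_def)
    have bR: "b \<notin> a ` R" using inj_a y1(1) by (auto simp: b_def R_def inj_on_def)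
    have im: "(a(v := b)) ` insert v R = insert b (a ` R)" using v(3) by auto
    have "card N + card (insert v R) \<le> d"
    proof (rule robust_system_bound[OF c0])
      show "c0 \<notin> c ` N" using c0G NG by auto
      show "c0 \<notin> (a(v := b)) ` insert v R"
        unfolding im using c0_not_abundant R(1) y1(1) by (auto simp: b_def)
      show "rainbow_matching V c N"
        using matching_in_mono[OF N(1) G(1)] inj_on_subset[OF injG NG]
        by (simp add: rainbow_matching_def)
      show "insert v R \<subseteq> V" using R(3) v(2) by auto
      show "insert v R \<inter> \<Union>N = {}"
      proof (rule ccontr)
        assume "insert v R \<inter> \<Union>N \<noteq> {}"
        then obtain y e where "y \<in> R" "e \<in> N" "y \<in> e" using N(3) by auto
        then show False using color_seen[of e y] RG[of y] NG G(1) by blast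
      qed
      have "inj_on a R" using inj_a R(1) by (rule inj_on_subset)
      then show "inj_on (a(v := b)) (insert v R)"
        using v(3) bR by (auto simp: inj_on_def)
      show "(a(v := b)) ` insert v R \<inter> c ` N = {}"
        unfolding im using aG NG R(1) y1(1) by (auto simp: b_def)
      show "abundant y ((a(v := b)) y)" if "y \<in> insert v R" for y
        using that v(1) abundant_a R(1) by auto
    qed
    then show False using tight N(2) v(3) R(2) by simp
  qed
  \<comment> \<open>All neighbors of \<open>z2\<close> in \<open>G\<close> are missable and
    \<open>y1\<close> is not, so the \<open>d\<close> edges at \<open>z2\<close> lie in
    \<open>E2\<close>, and the color of \<open>{z2, y1}\<close> is the only other one at
    \<open>z2\<close>.\<close>
  obtain z2 where z2: "missable G z2" "d \<le> degree G z2"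
    "\<And>e u. e \<in> G \<Longrightarrow> z2 \<in> e \<Longrightarrow> u \<in> e \<Longrightarrow> missable G u"
    using missable_full_degree_vertex[OF gG degG d(1) moreG] by metis
  have ny1: "\<not> missable G y1"
    using not_missed[of y1] y1(1) Q abundant_a[OF y1(1)] by (auto simp: b_def R_def)
  then have "{e \<in> G. z2 \<in> e} = {e \<in> E2. z2 \<in> e}"
    using z2(3) E1(1) by (auto simp: G_def)
  then have deg2: "d \<le> degree E2 z2" using z2(2) by (simp add: degree_def)
  note z2V = full_degree_unique_color(1)[OF E2(1,3) deg2]
  note z21 = full_degree_unique_color(2)[OF E2(1,3) deg2]
  have "z2 \<noteq> y1" using ny1 z2(1) by auto
  then have "c {z2, y1} \<in> seen V c z2" and in_y1: "c {z2, y1} \<in> seen V c y1"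
    using seen_edge[OF z2V, of y1] seen_edge'[OF z2V, of y1] y1(1) Q(1) by auto
  then have other: "c {z2, y1} \<in> seen V c z2 - c ` E2" using E2(2) by auto
  have c0z2: "c0 \<notin> seen V c z2"
  proof
    assume "c0 \<in> seen V c z2"
    then have "c0 \<in> seen V c z2 - c ` E2" using E2(2) by (auto simp: A_def)
    then show False using z21[OF other] in_y1 Q(2)[OF y1(1)] by metis
  qed
  then obtain y where y: "y \<in> Q" "abundant z2 (a y)" using saturated[OF z2V] by auto
  have "a y \<in> seen V c z2 - c ` E2"
    using abundant_seen[OF y(2)] aG y(1) G(2) E2(2) by auto
  then have ay: "a y \<in> seen V c y1" using z21[OF other] in_y1 by metis
  \<comment> \<open>Otherwise \<open>y1\<close> shares two colors, \<open>b\<close> and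
    \<open>a y\<close>, with \<open>y\<close>, so it adds at most \<open>d - 1\<close> colors to
    those of \<open>R\<close>, against the tight size of \<open>L\<close>.\<close>
  have "y = y1"
  proof (rule ccontr)
    assume ny: "y \<noteq> y1"
    then have yR: "y \<in> R" using y(1) by (simp add: R_def)
    have ab: "a y \<noteq> b" using inj_a y(1) y1(1) ny by (auto simp: b_def inj_on_def)
    have "L \<subseteq> (\<Union>y\<in>R. seen V c y) \<union> (seen V c y1 - {b, a y})"
    proof
      fix x assume "x \<in> L"
      then obtain w where w: "w \<in> Q" "x \<in> seen V c w" by (auto simp: L_def)
      show "x \<in> (\<Union>y\<in>R. seen V c y) \<union> (seen V c y1 - {b, a y})"
      proof (cases "w = y1 \<and> x \<notin> {b, a y}")
        case False
        then have "x \<in> seen V c y \<or> w \<in> R"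
          using w b_all[OF y(1)] abundant_color_seen[OF y(1)] by (auto simp: R_def)
        then show ?thesis using yR w by auto
      qed (use w in auto)
    qed
    then have "card L \<le> card ((\<Union>y\<in>R. seen V c y) \<union> (seen V c y1 - {b, a y}))"
      by (rule card_mono[rotated]) (use R(2) finite_seen in auto)
    also have "\<dots> \<le> card (\<Union>y\<in>R. seen V c y) + card (seen V c y1 - {b, a y})"
      by (rule card_Un_le)
    also have "card (seen V c y1 - {b, a y}) = card (seen V c y1) - 2"
      using card_Diff_subset[of "{b, a y}" "seen V c y1"] ab ay b_all[OF y1(1)] by simp
    also have "card (\<Union>y\<in>R. seen V c y) \<le> d * card R + 1" by (rule seen_Union_le[OF R(2,3)])
    finally have "card L \<le> d * card R + 1 + (card (seen V c y1) - 2)" by simp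
    moreover have "card (seen V c y1) \<le> d + 1" using seen_le y1(1) Q(1) by auto
    ultimately show False using cardL' d unfolding cardR distrib_left by linarith
  qed
  then have "abundant z2 b" using y(2) by (simp add: b_def)
  moreover have "z2 \<notin> R"
  proof
    assume "z2 \<in> R"
    then have "seen V c z2 \<inter> c ` G = {}" by (rule RG)
    then show False using degree_representatives[OF G(1) injG, of z2] z2(2) d by simp
  qed
  ultimately show False using not_missed[of z2] z2V c0z2 z2(1) by blast
qed

theorem card_colors_le:
  "card colors \<le> (if d = 1 then 3 else if even d then d * d + d + 1 else d * d + d div 2 + 1)"
proof -
  define L where "L = (\<Union>y\<in>Q. seen V c y)"
  obtain E where E: "E \<subseteq> K" "c ` E = colors - {c0} - L" "inj_on c E"
    and gE: "edge_graph E" and degE: "\<And>v. degree E v \<le> d"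
    and nuE: "matching_number E + card Q \<le> d"
    and nuE': "d * matching_number E + d * card Q \<le> d * d"
    and total: "card colors = 1 + card L + card E"
    using outside_system_graph_exists unfolding L_def by metis
  have cardL: "card L \<le> d * card Q + 1" unfolding L_def by (rule seen_Union_le[OF finite_Q Q(1)])
  show ?thesis
  proof (cases "even d")
    case True
    have "card E \<le> (d + 1) * matching_number E" by (rule chvatal_hanson_even[OF gE degE True])
    then have "card E \<le> d * matching_number E + matching_number E" by simp
    moreover have "card L + matching_number E \<le> d * card Q + d"
    proof (cases "Q = {}")
      case True
      then show ?thesis using nuE by (simp add: L_def)
    next
      case False
      then have "1 \<le> card Q" using finite_Q by (simp add: Suc_le_eq card_gt_0_iff)
      then show ?thesis using cardL nuE by linarith
    qed
    ultimately have "card colors \<le> d * d + d + 1" using total nuE' by linarith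
    then show ?thesis using True by auto
  next
    case False
    have odd: "card E \<le> d * matching_number E + d div 2"
      by (rule chvatal_hanson_odd[OF gE degE False]) (use nuE in simp)
    show ?thesis
    proof (cases "Q = {}")
      case True
      then have "card L = 0" "card Q = 0" by (auto simp: L_def)
      then have "card colors \<le> d * d + d div 2 + 1" using total odd nuE' by linarith
      then show ?thesis using False by auto
    next
      case ne: False
      show ?thesis
      proof (cases "d = 1")
        case True
        \<comment> \<open>Here \<open>Q\<close> is a single vertex, \<open>E\<close> has no edges
          and \<open>L\<close> at most two colors, which makes 3 with \<open>c0\<close>.\<close>
        have "1 \<le> card Q" using ne finite_Q by (simp add: Suc_le_eq card_gt_0_iff)
        then show ?thesis using True total odd nuE cardL by simp
      next
        case d1: False
        then have "3 \<le> d" using False by (auto elim!: oddE)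
        then show ?thesis using odd_case[OF False _ ne] False d1 by simp
      qed
    qed
  qed
qed

end

section \<open>Existence of a robust color\<close>

context rainbow_free
begin

lemma color_system_exists:
  assumes "robust x"
  obtains Q a where "color_system V c d x Q a"
proof -
  define Y where "Y = {y \<in> V. x \<notin> seen V c y}"
  define P where "P Q a \<longleftrightarrow> Q \<subseteq> Y \<and> inj_on a Q \<and> (\<forall>y\<in>Q. abundant y (a y))" for Q and a :: "'a \<Rightarrow> 'c"
  have finY: "finite Y" using finite_V by (simp add: Y_def)
  have "P {} a" for a by (simp add: P_def)
  moreover have "\<forall>Q. (\<exists>a. P Q a) \<longrightarrow> card Q < Suc (card Y)"
    using card_mono[OF finY] by (auto simp: P_def le_imp_less_Suc)
  ultimately obtain Q where Q: "\<exists>a. P Q a" "\<And>R. \<exists>a. P R a \<Longrightarrow> card R \<le> card Q"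
    using ex_has_greatest_nat[of "\<lambda>Q. \<exists>a. P Q a" "{}" card "Suc (card Y)"] by blast
  then obtain a where a: "P Q a" by blast
  have "\<exists>y\<in>Q. abundant v (a y)" if v: "v \<in> V" "x \<notin> seen V c v" for v
  proof (rule ccontr)
    assume no: "\<not> (\<exists>y\<in>Q. abundant v (a y))"
    obtain w where w: "abundant v w" using abundant_exists[OF v(1)] by auto
    have vQ: "v \<notin> Q" using no a by (auto simp: P_def)
    have "w \<notin> a ` Q" using no w by auto
    then have "P (insert v Q) (a(v := w))"
      using a v w vQ by (auto simp: P_def Y_def inj_on_def)
    then have "card (insert v Q) \<le> card Q" using Q(2) by blast
    moreover have "finite Q" using a finY finite_subset by (auto simp: P_def)
    ultimately show False using vQ by simp
  qed
  then have "color_system V c d x Q a"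
    using a assms by unfold_locales (auto simp: P_def Y_def)
  then show ?thesis using that by blast
qed

lemma maximum_rainbow_matching_exists:
  obtains M where "rainbow_matching V c M" "card M \<le> d + 1"
    "\<And>e. e \<in> K \<Longrightarrow> e \<inter> \<Union>M = {} \<Longrightarrow> c e \<in> c ` M"
proof -
  have "rainbow_matching V c {}" by (simp add: rainbow_matching_def matching_in_def)
  moreover have "\<forall>M. rainbow_matching V c M \<longrightarrow> card M < d + 2"
    using rainbow_matching_le by (simp add: less_Suc_eq_le)
  ultimately obtain M where M: "rainbow_matching V c M"
    "\<And>N. rainbow_matching V c N \<Longrightarrow> card N \<le> card M"
    using ex_has_greatest_nat[of "rainbow_matching V c" "{}" card "d + 2"] by blast
  have "c e \<in> c ` M" if "e \<in> K" "e \<inter> \<Union>M = {}" for e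
  proof (rule ccontr)
    assume "c e \<notin> c ` M"
    note ins = rainbow_matching_insert[OF M(1) that this]
    show False using M(2)[OF ins(1)] ins(2) by linarith
  qed
  then show ?thesis using that M(1) rainbow_matching_le by blast
qed

lemma robust_exists_large:
  assumes "2 \<le> d"
  shows "\<exists>x. robust x"
proof (rule ccontr)
  assume no: "\<not> (\<exists>x. robust x)"
  obtain M where M: "rainbow_matching V c M" "card M \<le> d + 1"
    "\<And>e. e \<in> K \<Longrightarrow> e \<inter> \<Union>M = {} \<Longrightarrow> c e \<in> c ` M"
    using maximum_rainbow_matching_exists by metis
  have mM: "matching_in K M" using M(1) by (simp add: rainbow_matching_def)
  have finM: "finite M" using matching_in_finite[OF edge_graph_K mM] .
  have "\<forall>x. \<exists>X. finite X \<and> card X \<le> 2 * (d + 1) \<and> (\<forall>e\<in>K. c e = x \<longrightarrow> e \<inter> X \<noteq> {})"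
  proof
    fix x
    have "\<not> robust x" using no by blast
    then show "\<exists>X. finite X \<and> card X \<le> 2 * (d + 1) \<and> (\<forall>e\<in>K. c e = x \<longrightarrow> e \<inter> X \<noteq> {})"
      unfolding robust_def by (simp only: not_all not_imp bex_simps Ball_def) metis
  qed
  then obtain X where X: "\<And>x. finite (X x)" "\<And>x. card (X x) \<le> 2 * (d + 1)"
    "\<And>x e. e \<in> K \<Longrightarrow> c e = x \<Longrightarrow> e \<inter> X x \<noteq> {}" by metis
  define B where "B = \<Union>M \<union> (\<Union>x\<in>c ` M. X x)"
  have "finite (\<Union>M)"
    using finite_Union_edges edge_graph_subset[OF edge_graph_K] mM by (metis matching_in_def)
  then have finB: "finite B" using X(1) finM by (simp add: B_def)
  have "card (\<Union>x\<in>c ` M. X x) \<le> (\<Sum>x\<in>c ` M. card (X x))"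
    by (rule card_UN_le) (simp add: finM)
  also have "\<dots> \<le> (\<Sum>x\<in>c ` M. 2 * (d + 1))" by (rule sum_mono) (rule X(2))
  also have "\<dots> = card (c ` M) * (2 * (d + 1))" by (simp only: sum_constant of_nat_id)
  also have "\<dots> \<le> (d + 1) * (2 * (d + 1))"
    by (rule mult_le_mono1) (use card_image_le[OF finM, of c] M(2) in simp)
  finally have "card (\<Union>x\<in>c ` M. X x) \<le> (d + 1) * (2 * (d + 1))" .
  moreover have "card (\<Union>M) \<le> 2 * (d + 1)"
    using card_Union_matching[OF edge_graph_K mM] M(2) by simp
  ultimately have "card B \<le> 2 * (d + 1) + (d + 1) * (2 * (d + 1))"
    unfolding B_def by (rule order_trans[OF card_Un_le add_mono[rotated]])
  \<comment> \<open>At least \<open>3(d + 1)\<^sup>2 - 2(d + 1)\<^sup>2 - 2(d + 1) = d\<^sup>2 -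
    1\<close> vertices survive; two are needed for an edge, hence \<open>d \<ge> 2\<close>.\<close>
  moreover have "2 * (d + 1) + (d + 1) * (2 * (d + 1)) + 2 \<le> 3 * (d + 1)\<^sup>2"
  proof -
    have "2 * 2 \<le> d * d" using assms by (intro mult_le_mono) auto
    then show ?thesis by (simp add: power2_eq_square algebra_simps)
  qed
  ultimately have "2 \<le> card V - card B" using many_vertices by linarith
  also have "\<dots> \<le> card (V - B)" by (rule diff_card_le_card_Diff[OF finB])
  finally obtain e where e: "e \<subseteq> V - B" "card e = 2"
    by (rule obtain_subset_with_card_n)
  have eK: "e \<in> K" using e finite_V by (auto simp: nsets_def intro: finite_subset)
  have "c e \<in> c ` M" by (rule M(3)[OF eK]) (use e in \<open>auto simp: B_def\<close>)
  then have "X (c e) \<subseteq> B" by (auto simp: B_def)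
  then show False using X(3)[OF eK refl] e by blast
qed

text \<open>For \<open>d = 1\<close> deleting blocking sets may exhaust all 12 vertices. Instead,
  \<open>M\<close> has at most two colors and an edge \<open>e\<close> of a third color meets it, so
  \<open>M\<close> and \<open>e\<close> cover at most 5 vertices and \<open>W\<close> keeps 7.
  Disjoint edges in \<open>W\<close> have colors of \<open>M\<close>; if these differed, the two
  edges and \<open>e\<close> would form a rainbow matching of size 3. Any two edges of
  \<open>W\<close> are disjoint from a third, so \<open>W\<close> is monochromatic, and its color
  survives the deletion of 4 vertices.\<close>

lemma robust_exists_small:
  assumes d: "d = 1" and many: "3 \<le> card colors"
  shows "\<exists>x. robust x"
proof -
  obtain M where M: "rainbow_matching V c M" "card M \<le> d + 1"
    "\<And>e. e \<in> K \<Longrightarrow> e \<inter> \<Union>M = {} \<Longrightarrow> c e \<in> c ` M"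
    using maximum_rainbow_matching_exists by metis
  have mM: "matching_in K M" using M(1) by (simp add: rainbow_matching_def)
  have finM: "finite M" using matching_in_finite[OF edge_graph_K mM] .
  have "\<not> colors \<subseteq> c ` M"
    using card_mono[of "c ` M" colors] card_image_le[OF finM, of c] finM M(2) many d by auto
  then obtain e where e: "e \<in> K" "c e \<notin> c ` M" by auto
  have meet: "e \<inter> \<Union>M \<noteq> {}" using M(3)[OF e(1)] e(2) by blast
  define W where "W = V - (\<Union>M \<union> e)"
  have fe: "finite e" "card e = 2" using e(1) by (auto simp: nsets_def)
  have finU: "finite (\<Union>M)"
    using finite_Union_edges edge_graph_subset[OF edge_graph_K] mM by (metis matching_in_def)
  have "card (\<Union>M) \<le> 4" using card_Union_matching[OF edge_graph_K mM] M(2) d by simp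
  moreover have "card (\<Union>M \<union> e) + card (\<Union>M \<inter> e) = card (\<Union>M) + card e"
    using card_Un_Int[OF finU fe(1)] by simp
  moreover have "0 < card (\<Union>M \<inter> e)" using meet finU by (metis card_gt_0_iff finite_Int inf_commute)
  ultimately have "card (\<Union>M \<union> e) \<le> 5" using fe by linarith
  moreover have "card V - card (\<Union>M \<union> e) \<le> card W"
    unfolding W_def by (rule diff_card_le_card_Diff) (use finU fe in simp)
  moreover have "12 \<le> card V" using many_vertices d by (simp add: power2_eq_square)
  ultimately have W: "7 \<le> card W" by linarith
  have finW: "finite W" using finite_V by (simp add: W_def)
  have sub: "f \<in> K" if "f \<subseteq> W" "card f = 2" for f
    using that finite_V by (auto simp: nsets_def W_def intro: finite_subset)
  have pick: "\<exists>f. f \<subseteq> W \<and> card f = 2 \<and> f \<inter> X = {}" if "finite X" "card X \<le> 4" for X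
  proof -
    have "2 \<le> card (W - X)" using diff_card_le_card_Diff[OF that(1), of W] that(2) W by linarith
    then obtain f where "f \<subseteq> W - X" "card f = 2" by (rule obtain_subset_with_card_n)
    then show ?thesis by blast
  qed
  have disj: "c f = c g" if fg: "f \<subseteq> W" "card f = 2" "g \<subseteq> W" "card g = 2" "f \<inter> g = {}" for f g
  proof (rule ccontr)
    assume ne: "c f \<noteq> c g"
    have "f \<inter> \<Union>M = {}" "g \<inter> \<Union>M = {}" using fg(1,3) unfolding W_def by blast+
    then have "c f \<in> c ` M" "c g \<in> c ` M" using M(3)[OF sub] fg by blast+
    then have cne: "c e \<noteq> c f" "c e \<noteq> c g" using e(2) by auto
    have "rainbow_matching V c {}" by (simp add: rainbow_matching_def matching_in_def)
    from rainbow_matching_insert[OF this e(1)]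
    have 1: "rainbow_matching V c {e}" by simp
    have fe0: "f \<inter> e = {}" "g \<inter> e = {}" using fg by (auto simp: W_def)
    have 2: "rainbow_matching V c {f, e}" "card {f, e} = 2"
      using rainbow_matching_insert[OF 1 sub[OF fg(1,2)]] fe0 cne by auto
    have "rainbow_matching V c {g, f, e}" "card {g, f, e} = 3"
      using rainbow_matching_insert[OF 2(1) sub[OF fg(3,4)]] fe0 cne ne fg(5) 2(2)
      by (auto simp: Int_Un_distrib Int_commute)
    then show False using rainbow_matching_le[of "{g, f, e}"] d by simp
  qed
  obtain f0 where f0: "f0 \<subseteq> W" "card f0 = 2" using pick[of "{}"] by auto
  have mono: "c f = c f0" if f: "f \<subseteq> W" "card f = 2" for f
  proof -
    have "finite (f \<union> f0)" using f f0 finW by (auto intro: finite_subset)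
    moreover have "card (f \<union> f0) \<le> 4" using card_Un_le[of f f0] f f0 by simp
    ultimately obtain g where "g \<subseteq> W" "card g = 2" "g \<inter> (f \<union> f0) = {}" using pick by blast
    then show ?thesis using disj[of g f] disj[of g f0] f f0 by (auto simp: Int_Un_distrib)
  qed
  have "robust (c f0)" unfolding robust_def
  proof (intro allI impI)
    fix X :: "'a set" assume "finite X" "card X \<le> 2 * (d + 1)"
    then obtain f where "f \<subseteq> W" "card f = 2" "f \<inter> X = {}" using pick[of X] d by auto
    then show "\<exists>e\<in>K. c e = c f0 \<and> e \<inter> X = {}" using mono sub by blast
  qed
  then show ?thesis by blast
qed

theorem card_colors_bound:
  "card colors \<le> (if d = 1 then 3 else if even d then d * d + d + 1 else d * d + d div 2 + 1)"
proof (cases "\<exists>x. robust x")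
  case True
  then obtain x where "robust x" by auto
  then obtain Q a where "color_system V c d x Q a" using color_system_exists by blast
  then show ?thesis by (rule color_system.card_colors_le)
next
  case False
  then have "d = 1" using robust_exists_large d_pos by force
  moreover from this have "card colors \<le> 3" using robust_exists_small False by (meson nat_le_linear)
  ultimately show ?thesis by simp
qed

end

section \<open>Rainbow copies and the anti-Ramsey number\<close>

lemma graph_iso_sym:
  assumes "graph_iso G H"
  shows "graph_iso H G"
proof -
  obtain f where f: "bij_betw f (verts G) (verts H)"
    "\<And>u v. u \<in> verts G \<Longrightarrow> v \<in> verts G \<Longrightarrow> {u, v} \<in> edges G \<longleftrightarrow> {f u, f v} \<in> edges H"
    using assms by (auto simp: graph_iso_def)
  let ?g = "inv_into (verts G) f"
  have g: "bij_betw ?g (verts H) (verts G)" using f(1) by (rule bij_betw_inv_into)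
  have "{u, v} \<in> edges H \<longleftrightarrow> {?g u, ?g v} \<in> edges G" if "u \<in> verts H" "v \<in> verts H" for u v
    using that f(2)[of "?g u" "?g v"] g f(1)
    by (simp add: bij_betw_apply bij_betw_inv_into_right)
  then show ?thesis using g by (auto simp: graph_iso_def)
qed

lemma has_rainbow_star_iff:
  fixes c :: "nat set \<Rightarrow> 'c"
  assumes "1 \<le> m"
  shows "has_rainbow_copy c (complete_graph n) (star_graph m) \<longleftrightarrow>
    (\<exists>v<n. m \<le> card (seen {..<n} c v))"
proof
  assume "has_rainbow_copy c (complete_graph n) (star_graph m)"
  then obtain S where S: "subgraph S (complete_graph n)" "graph_iso (star_graph m) S" "rainbow c S"
    using graph_iso_sym unfolding has_rainbow_copy_def by metis
  then obtain g where g: "bij_betw g {..m} (verts S)"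
    "\<And>u v. u \<le> m \<Longrightarrow> v \<le> m \<Longrightarrow>
      {u, v} \<in> {{0, i} |i. 1 \<le> i \<and> i \<le> m} \<longleftrightarrow> {g u, g v} \<in> edges S"
    by (auto simp: graph_iso_def star_graph_def)
  have V: "g i < n" if "i \<le> m" for i
    using that S(1) bij_betw_apply[OF g(1)] by (auto simp: subgraph_def complete_graph_def)
  have inj: "g i = g j \<longleftrightarrow> i = j" if "i \<le> m" "j \<le> m" for i j
    using that bij_betw_imp_inj_on[OF g(1)] by (auto simp: inj_on_def)
  have edge: "{g 0, g i} \<in> edges S" if "i \<in> {1..m}" for i
    using that g(2)[of 0 i] by auto
  have "inj_on (\<lambda>i. c {g 0, g i}) {1..m}"
  proof (rule inj_onI)
    fix i j assume ij: "i \<in> {1..m}" "j \<in> {1..m}" "c {g 0, g i} = c {g 0, g j}"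
    then have "{g 0, g i} = {g 0, g j}"
      using edge S(3) unfolding rainbow_def inj_on_def by blast
    then have "g i = g j" by (auto simp: doubleton_eq_iff)
    then show "i = j" using inj ij by auto
  qed
  moreover have "(\<lambda>i. c {g 0, g i}) ` {1..m} \<subseteq> seen {..<n} c (g 0)"
    using V inj[of _ 0] by (auto simp: seen_def)
  ultimately have "card {1..m} \<le> card (seen {..<n} c (g 0))"
    by (rule card_inj_on_le) (simp add: seen_def)
  then show "\<exists>v<n. m \<le> card (seen {..<n} c v)" using V[of 0] by auto
next
  assume "\<exists>v<n. m \<le> card (seen {..<n} c v)"
  then obtain v where v: "v < n" "m \<le> card (seen {..<n} c v)" by auto
  obtain T where T: "T \<subseteq> seen {..<n} c v" "card T = m"
    using obtain_subset_with_card_n[OF v(2)] by blast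
  obtain W where W: "W \<subseteq> {..<n} - {v}" "inj_on (\<lambda>w. c {v, w}) W" "T = (\<lambda>w. c {v, w}) ` W"
    using T(1) unfolding seen_def subset_image_inj by metis
  have cW: "card W = m" using T(2) W(2,3) card_image by metis
  have finW: "finite W" using W(1) finite_subset by blast
  obtain h where h: "bij_betw h W {1..m}"
    using finite_same_card_bij[OF finW, of "{1..m}"] cW by auto
  define S where "S = (insert v W, (\<lambda>w. {v, w}) ` W)"
  have vW: "v \<notin> W" using W(1) by auto
  have "subgraph S (complete_graph n)"
    using W(1) v(1) finW vW
    by (auto simp: subgraph_def simple_graph_def complete_graph_def S_def nsets_def card_insert_if)
  moreover have "rainbow c S"
    using W(2) by (auto simp: rainbow_def S_def inj_on_def)
  moreover have "graph_iso S (star_graph m)"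
  proof -
    define f where "f x = (if x = v then 0 else h x)" for x
    have hW: "h w \<in> {1..m}" if "w \<in> W" for w using that bij_betw_apply[OF h] by blast
    have fv: "f v = 0" by (simp add: f_def)
    have fW: "f w = h w" if "w \<in> W" for w using that vW by (auto simp: f_def)
    have "bij_betw f W {1..m}" using h bij_betw_cong[of W f h] fW by blast
    then have "bij_betw f (W \<union> {v}) ({1..m} \<union> {f v})"
      by (intro notIn_Un_bij_betw) (use vW fv in auto)
    moreover have "{1..m} \<union> {f v} = {..m}" using fv by auto
    ultimately have bij: "bij_betw f (insert v W) {..m}" by simp
    have "{x, y} \<in> (\<lambda>w. {v, w}) ` W \<longleftrightarrow> {f x, f y} \<in> {{0, i} |i. 1 \<le> i \<and> i \<le> m}"
      if xy: "x \<in> insert v W" "y \<in> insert v W" for x y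
    proof
      assume "{x, y} \<in> (\<lambda>w. {v, w}) ` W"
      then obtain w where w: "w \<in> W" "{x, y} = {v, w}" by auto
      then have "{f x, f y} = {0, h w}" using fv fW[OF w(1)] by (auto simp: doubleton_eq_iff)
      then show "{f x, f y} \<in> {{0, i} |i. 1 \<le> i \<and> i \<le> m}" using hW[OF w(1)] by auto
    next
      assume "{f x, f y} \<in> {{0, i} |i. 1 \<le> i \<and> i \<le> m}"
      then obtain i where i: "{f x, f y} = {0, i}" "1 \<le> i" by auto
      then have one: "f x = 0 \<and> f y \<noteq> 0 \<or> f y = 0 \<and> f x \<noteq> 0" by (auto simp: doubleton_eq_iff)
      have zero: "f u = 0 \<longleftrightarrow> u = v" if "u \<in> insert v W" for u
        using that fW[of u] hW[of u] by (auto simp: f_def)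
      have "x = v \<and> y \<in> W \<or> y = v \<and> x \<in> W"
        using one xy unfolding zero[OF xy(1)] zero[OF xy(2)] by blast
      then show "{x, y} \<in> (\<lambda>w. {v, w}) ` W" by (auto simp: insert_commute)
    qed
    then show ?thesis using bij by (auto simp: graph_iso_def S_def star_graph_def)
  qed
  ultimately show "has_rainbow_copy c (complete_graph n) (star_graph m)"
    unfolding has_rainbow_copy_def by blast
qed

lemma has_rainbow_matching_iff:
  fixes c :: "nat set \<Rightarrow> 'c"
  shows "has_rainbow_copy c (complete_graph n) (matching_graph m) \<longleftrightarrow>
    (\<exists>M. rainbow_matching {..<n} c M \<and> card M = m)"
proof
  assume "has_rainbow_copy c (complete_graph n) (matching_graph m)"
  then obtain S where S: "subgraph S (complete_graph n)" "graph_iso (matching_graph m) S" "rainbow c S"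
    using graph_iso_sym unfolding has_rainbow_copy_def by metis
  then obtain g where g: "bij_betw g {..<2 * m} (verts S)"
    "\<And>u v. u < 2 * m \<Longrightarrow> v < 2 * m \<Longrightarrow>
      {u, v} \<in> {{2 * i, 2 * i + 1} |i. i < m} \<longleftrightarrow> {g u, g v} \<in> edges S"
    by (auto simp: graph_iso_def matching_graph_def)
  have inj: "g i = g j \<longleftrightarrow> i = j" if "i < 2 * m" "j < 2 * m" for i j
    using that bij_betw_imp_inj_on[OF g(1)] by (auto simp: inj_on_def)
  define e where "e i = {g (2 * i), g (2 * i + 1)}" for i
  have edge: "e i \<in> edges S" if "i < m" for i
    unfolding e_def using that g(2)[of "2 * i" "2 * i + 1"] by auto
  have dis: "e i \<inter> e j = {}" if "i < m" "j < m" "i \<noteq> j" for i j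
  proof -
    have "2 * i \<noteq> 2 * j + 1" "2 * j \<noteq> 2 * i + 1" by presburger+
    then show ?thesis using that by (auto simp: e_def inj)
  qed
  have "inj_on e {..<m}"
  proof (rule inj_onI)
    fix i j assume "i \<in> {..<m}" "j \<in> {..<m}" "e i = e j"
    then show "i = j" using dis[of i j] by (auto simp: e_def)
  qed
  then have "card (e ` {..<m}) = m" by (simp add: card_image)
  moreover have "rainbow_matching {..<n} c (e ` {..<m})"
    unfolding rainbow_matching_def matching_in_def
  proof (intro conjI)
    have "edges S \<subseteq> [{..<n}]\<^bsup>2\<^esup>" using S(1) by (auto simp: subgraph_def complete_graph_def)
    then show "e ` {..<m} \<subseteq> [{..<n}]\<^bsup>2\<^esup>" using edge by blast
    show "pairwise disjnt (e ` {..<m})" using dis unfolding pairwise_def disjnt_def by blast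
    show "inj_on c (e ` {..<m})"
      using S(3) unfolding rainbow_def by (rule inj_on_subset) (use edge in blast)
  qed
  ultimately show "\<exists>M. rainbow_matching {..<n} c M \<and> card M = m" by blast
next
  assume "\<exists>M. rainbow_matching {..<n} c M \<and> card M = m"
  then obtain M where M: "M \<subseteq> [{..<n}]\<^bsup>2\<^esup>" "pairwise disjnt M" "inj_on c M" "card M = m"
    by (auto simp: rainbow_matching_def matching_in_def)
  have finM: "finite M" using M(1) by (rule finite_subset) (simp add: finite_imp_finite_nsets)
  obtain \<phi> where \<phi>: "bij_betw \<phi> {..<m} M"
    using finite_same_card_bij[OF _ finM, of "{..<m}"] M(4) by auto
  have "\<forall>i. \<exists>p q. i < m \<longrightarrow> \<phi> i = {p, q} \<and> p \<noteq> q"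
  proof
    fix i
    show "\<exists>p q. i < m \<longrightarrow> \<phi> i = {p, q} \<and> p \<noteq> q"
    proof (cases "i < m")
      case True
      then have "\<phi> i \<in> M" using bij_betw_apply[OF \<phi>] by blast
      then have "card (\<phi> i) = 2" using M(1) by (auto simp: nsets_def)
      then show ?thesis by (auto simp: card_2_iff)
    qed simp
  qed
  then obtain p q where pq: "\<And>i. i < m \<Longrightarrow> \<phi> i = {p i, q i}" "\<And>i. i < m \<Longrightarrow> p i \<noteq> q i" by metis
  \<comment> \<open>Even numbers go to one end of an edge and odd numbers to the other, so
    \<open>{2i, 2i + 1}\<close> goes to the \<open>i\<close>-th edge of \<open>M\<close>.\<close>
  define g where "g j = (if even j then p (j div 2) else q (j div 2))" for j
  have g\<phi>: "g j \<in> \<phi> (j div 2)" if "j < 2 * m" for j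
    using that pq(1)[of "j div 2"] by (auto simp: g_def)
  have \<phi>_inj: "i = j" if "i < m" "j < m" "x \<in> \<phi> i" "x \<in> \<phi> j" for i j x
  proof (rule ccontr)
    assume "i \<noteq> j"
    then have "\<phi> i \<noteq> \<phi> j" using that bij_betw_imp_inj_on[OF \<phi>] by (auto simp: inj_on_def)
    moreover have "\<phi> i \<in> M" "\<phi> j \<in> M" using that bij_betw_apply[OF \<phi>] by auto
    ultimately have "disjnt (\<phi> i) (\<phi> j)" using M(2) by (auto simp: pairwise_def)
    then show False using that by (auto simp: disjnt_def)
  qed
  have half: "j div 2 < m" if "j < 2 * m" for j using that by auto
  have g_inj: "inj_on g {..<2 * m}"
  proof (rule inj_onI)
    fix i j assume ij: "i \<in> {..<2 * m}" "j \<in> {..<2 * m}" "g i = g j"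
    then have d: "i div 2 = j div 2"
      using \<phi>_inj[of "i div 2" "j div 2" "g i"] g\<phi>[of i] g\<phi>[of j] half by auto
    have "even i \<longleftrightarrow> even j"
      using ij(3) pq(2)[of "j div 2"] half[of j] ij(2) d by (auto simp: g_def split: if_splits)
    then show "i = j" using d by (metis div_mult_mod_eq parity_cases)
  qed
  have g_im: "g ` {..<2 * m} = \<Union>M"
  proof
    show "g ` {..<2 * m} \<subseteq> \<Union>M" using g\<phi> half bij_betw_apply[OF \<phi>] by blast
    show "\<Union>M \<subseteq> g ` {..<2 * m}"
    proof
      fix x assume "x \<in> \<Union>M"
      then obtain i where i: "i < m" "x \<in> \<phi> i" using bij_betw_imp_surj_on[OF \<phi>] by blast
      have "g (2 * i) = p i" "g (2 * i + 1) = q i" by (simp_all add: g_def)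
      then have "x = g (2 * i) \<or> x = g (2 * i + 1)" using i pq(1)[of i] by auto
      moreover have "2 * i < 2 * m" "2 * i + 1 < 2 * m" using i(1) by auto
      ultimately show "x \<in> g ` {..<2 * m}" by blast
    qed
  qed
  define S where "S = (\<Union>M, M)"
  have "subgraph S (complete_graph n)"
    using M(1) finM by (auto simp: subgraph_def simple_graph_def complete_graph_def S_def nsets_def)
  moreover have "rainbow c S" using M(3) by (simp add: rainbow_def S_def)
  moreover have "graph_iso (matching_graph m) S"
  proof -
    have "{u, v} \<in> {{2 * i, 2 * i + 1} |i. i < m} \<longleftrightarrow> {g u, g v} \<in> M"
      if uv: "u < 2 * m" "v < 2 * m" for u v
    proof
      assume "{u, v} \<in> {{2 * i, 2 * i + 1} |i. i < m}"
      then obtain i where i: "i < m" "{u, v} = {2 * i, 2 * i + 1}" by auto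
      have "g ` {u, v} = {p i, q i}" unfolding i(2) by (auto simp: g_def)
      then have "{g u, g v} = \<phi> i" using pq(1)[OF i(1)] by simp
      then show "{g u, g v} \<in> M" using bij_betw_apply[OF \<phi>] i(1) by auto
    next
      assume e: "{g u, g v} \<in> M"
      then obtain i where i: "i < m" "{g u, g v} = \<phi> i" using bij_betw_imp_surj_on[OF \<phi>] by blast
      have "u div 2 = i" "v div 2 = i"
        using \<phi>_inj[OF half[OF uv(1)] i(1) g\<phi>[OF uv(1)]] \<phi>_inj[OF half[OF uv(2)] i(1) g\<phi>[OF uv(2)]] i(2)
        by auto
      moreover have "u \<noteq> v" using e M(1) by (auto simp: nsets_def)
      ultimately have "{u, v} = {2 * i, 2 * i + 1}" by auto
      then show "{u, v} \<in> {{2 * i, 2 * i + 1} |i. i < m}" using i(1) by blast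
    qed
    then show ?thesis
      unfolding graph_iso_def using g_inj g_im
      by (intro exI[of _ g]) (auto simp: matching_graph_def S_def bij_betw_def)
  qed
  ultimately show "has_rainbow_copy c (complete_graph n) (matching_graph m)"
    unfolding has_rainbow_copy_def using graph_iso_sym by blast
qed

section \<open>Reduction of the anti-Ramsey number to one coloring and one upper bound\<close>

definition avoids_rainbow :: "'a set \<Rightarrow> ('a set \<Rightarrow> 'c) \<Rightarrow> nat \<Rightarrow> bool" where
  "avoids_rainbow V c k \<longleftrightarrow>
     (\<forall>v\<in>V. card (seen V c v) \<le> k) \<and> (\<forall>M. rainbow_matching V c M \<longrightarrow> card M \<le> k)"

lemma avoids_rainbow_iff:
  fixes c :: "nat set \<Rightarrow> 'c"
  shows "avoids_rainbow {..<n} c k \<longleftrightarrow>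
    (\<forall>H\<in>{star_graph (k + 1), matching_graph (k + 1)}. \<not> has_rainbow_copy c (complete_graph n) H)"
proof -
  have "(\<exists>M. rainbow_matching {..<n} c M \<and> card M = k + 1) \<longleftrightarrow>
      (\<exists>M. rainbow_matching {..<n} c M \<and> \<not> card M \<le> k)"
  proof
    assume "\<exists>M. rainbow_matching {..<n} c M \<and> \<not> card M \<le> k"
    then obtain M where M: "rainbow_matching {..<n} c M" "k + 1 \<le> card M" by auto
    obtain N where "N \<subseteq> M" "card N = k + 1" using obtain_subset_with_card_n[OF M(2)] by blast
    then show "\<exists>M. rainbow_matching {..<n} c M \<and> card M = k + 1"
      using M(1) matching_in_subset inj_on_subset unfolding rainbow_matching_def by metis
  qed auto
  then show ?thesis
    unfolding avoids_rainbow_def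
    by (auto simp: has_rainbow_star_iff has_rainbow_matching_iff not_le Suc_le_eq leD)
qed

text \<open>Minimality requires a coloring with exactly \<open>y\<close> colors for every smaller
  \<open>y\<close>. Identifying colors creates no rainbow subgraph, so a single extremal coloring,
  with colors of any type, supplies them all.\<close>

lemma merge_colors:
  fixes c :: "nat set \<Rightarrow> 'c"
  assumes "avoids_rainbow V c k" "finite V" "1 \<le> y" "y \<le> card (c ` [V]\<^bsup>2\<^esup>)"
  obtains c' :: "nat set \<Rightarrow> nat" where "avoids_rainbow V c' k" "card (c' ` [V]\<^bsup>2\<^esup>) = y"
proof -
  let ?C = "c ` [V]\<^bsup>2\<^esup>"
  have "finite ?C" using assms(2) by (simp add: finite_imp_finite_nsets)
  then obtain h where h: "bij_betw h ?C {0..<card ?C}" using ex_bij_betw_finite_nat by blast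
  define f where "f x = min (h x) (y - 1)" for x
  have "(f \<circ> c) ` [V]\<^bsup>2\<^esup> = (\<lambda>x. min x (y - 1)) ` (h ` ?C)" by (auto simp: f_def image_image)
  also have "\<dots> = (\<lambda>x. min x (y - 1)) ` {0..<card ?C}" using bij_betw_imp_surj_on[OF h] by simp
  also have "\<dots> = {0..<y}"
  proof
    show "{0..<y} \<subseteq> (\<lambda>x. min x (y - 1)) ` {0..<card ?C}"
    proof
      fix x assume "x \<in> {0..<y}"
      then have "x = min x (y - 1)" "x \<in> {0..<card ?C}" using assms(4) by auto
      then show "x \<in> (\<lambda>x. min x (y - 1)) ` {0..<card ?C}" by blast
    qed
  qed (use assms(3) in auto)
  finally have "card ((f \<circ> c) ` [V]\<^bsup>2\<^esup>) = y" by simp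
  moreover have "avoids_rainbow V (f \<circ> c) k"
    unfolding avoids_rainbow_def
  proof (intro conjI ballI allI impI)
    fix v assume "v \<in> V"
    have "seen V (f \<circ> c) v = f ` seen V c v" by (auto simp: seen_def image_image)
    moreover have "finite (seen V c v)" using assms(2) by (simp add: seen_def)
    ultimately have "card (seen V (f \<circ> c) v) \<le> card (seen V c v)" by (simp add: card_image_le)
    then show "card (seen V (f \<circ> c) v) \<le> k"
      using assms(1) \<open>v \<in> V\<close> by (auto simp: avoids_rainbow_def intro: le_trans)
  next
    fix M assume "rainbow_matching V (f \<circ> c) M"
    then have "rainbow_matching V c M" using inj_on_imageI2 by (auto simp: rainbow_matching_def)
    then show "card M \<le> k" using assms(1) by (simp add: avoids_rainbow_def)
  qed
  ultimately show ?thesis using that by blast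
qed

lemma anti_ramsey_eqI:
  fixes c :: "nat set \<Rightarrow> 'c"
  assumes c: "avoids_rainbow {..<n} c k" "card (c ` [{..<n}]\<^bsup>2\<^esup>) = R"
    and upper: "\<And>c :: nat set \<Rightarrow> nat. avoids_rainbow {..<n} c k \<Longrightarrow> card (c ` [{..<n}]\<^bsup>2\<^esup>) \<le> R"
  shows "anti_ramsey n {star_graph (k + 1), matching_graph (k + 1)} = R + 1"
  unfolding anti_ramsey_def
proof (rule Least_equality)
  let ?G = "{star_graph (k + 1), matching_graph (k + 1)}"
  have "\<exists>H\<in>?G. has_rainbow_copy c (complete_graph n) H"
    if "card (c ` edges (complete_graph n)) = R + 1" for c :: "nat set \<Rightarrow> nat"
    using upper[of c] that avoids_rainbow_iff[of n c k] by (auto simp: complete_graph_def)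
  then show "1 \<le> R + 1 \<and> (\<forall>c :: nat set \<Rightarrow> nat. card (c ` edges (complete_graph n)) = R + 1 \<longrightarrow>
      (\<exists>H\<in>?G. has_rainbow_copy c (complete_graph n) H))" by auto
next
  let ?G = "{star_graph (k + 1), matching_graph (k + 1)}"
  fix y assume y: "1 \<le> y \<and> (\<forall>c :: nat set \<Rightarrow> nat. card (c ` edges (complete_graph n)) = y \<longrightarrow>
      (\<exists>H\<in>?G. has_rainbow_copy c (complete_graph n) H))"
  show "R + 1 \<le> y"
  proof (rule ccontr)
    assume "\<not> R + 1 \<le> y"
    then obtain c' :: "nat set \<Rightarrow> nat" where
      "avoids_rainbow {..<n} c' k" "card (c' ` [{..<n}]\<^bsup>2\<^esup>) = y"
      using merge_colors[OF c(1), of y] y c(2) by auto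
    then show False using y avoids_rainbow_iff[of n c' k] by (auto simp: complete_graph_def)
  qed
qed

section \<open>Extremal colorings\<close>

text \<open>The two bounds are separate parameters because in a disjoint union the matching bounds
  add up while the degree bound stays.\<close>

definition bounded_graph :: "nat \<Rightarrow> nat \<Rightarrow> 'a set set \<Rightarrow> bool" where
  "bounded_graph d m H \<longleftrightarrow>
     edge_graph H \<and> (\<forall>v. degree H v \<le> d) \<and> (\<forall>M. matching_in H M \<longrightarrow> card M \<le> m)"

lemma bounded_graph_disjoint_union:
  assumes "bounded_graph d m1 H1" "bounded_graph d m2 H2" "\<Union>H1 \<inter> \<Union>H2 = {}"
  shows "bounded_graph d (m1 + m2) (H1 \<union> H2)" "card (H1 \<union> H2) = card H1 + card H2"
proof -
  have g: "edge_graph H1" "edge_graph H2" using assms by (auto simp: bounded_graph_def)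
  then have "edge_graph (H1 \<union> H2)" by (auto simp: edge_graph_def)
  moreover have "degree (H1 \<union> H2) v \<le> d" for v
  proof (cases "v \<in> \<Union>H1")
    case True
    then have "{e \<in> H1 \<union> H2. v \<in> e} = {e \<in> H1. v \<in> e}" using assms(3) by auto
    then show ?thesis using assms(1) by (metis bounded_graph_def degree_def)
  next
    case False
    then have "{e \<in> H1 \<union> H2. v \<in> e} = {e \<in> H2. v \<in> e}" by auto
    then show ?thesis using assms(2) by (metis bounded_graph_def degree_def)
  qed
  moreover have "card M \<le> m1 + m2" if M: "matching_in (H1 \<union> H2) M" for M
  proof -
    have "matching_in H1 (M \<inter> H1)" "matching_in H2 (M \<inter> H2)"
      using M by (auto simp: matching_in_def pairwise_def)
    then have "card (M \<inter> H1) \<le> m1" "card (M \<inter> H2) \<le> m2"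
      using assms by (auto simp: bounded_graph_def)
    moreover have "M = (M \<inter> H1) \<union> (M \<inter> H2)" using M by (auto simp: matching_in_def)
    ultimately show ?thesis using card_Un_le[of "M \<inter> H1" "M \<inter> H2"] by simp
  qed
  ultimately show "bounded_graph d (m1 + m2) (H1 \<union> H2)" by (simp add: bounded_graph_def)
  have "H1 \<inter> H2 = {}"
  proof (rule ccontr)
    assume "H1 \<inter> H2 \<noteq> {}"
    then obtain e where e: "e \<in> H1" "e \<in> H2" by auto
    then have "e \<noteq> {}" using g(1) by (auto simp: edge_graph_def)
    then show False using e assms(3) by auto
  qed
  then show "card (H1 \<union> H2) = card H1 + card H2"
    using g by (intro card_Un_disjoint) (auto simp: edge_graph_def)
qed

text \<open>All edges outside \<open>H\<close> share the color \<open>None\<close>, so they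
  contribute at most one color at a vertex and at most one edge to a rainbow matching.\<close>

lemma avoids_rainbow_of_graph:
  fixes V :: "'a set" and H :: "'a set set"
  defines "c \<equiv> \<lambda>e. if e \<in> H then Some e else None"
  assumes H: "bounded_graph d d H" "\<Union>H \<subset> V" and V: "finite V" "2 \<le> card V"
  shows "avoids_rainbow V c (d + 1)" "card (c ` [V]\<^bsup>2\<^esup>) = card H + 1"
proof -
  have g: "finite H" "\<And>e. e \<in> H \<Longrightarrow> card e = 2"
    using H(1) by (auto simp: bounded_graph_def edge_graph_def)
  show "avoids_rainbow V c (d + 1)"
    unfolding avoids_rainbow_def
  proof (intro conjI ballI allI impI)
    fix v assume "v \<in> V"
    have "seen V c v \<subseteq> insert None (Some ` {e \<in> H. v \<in> e})"
      by (auto simp: seen_def c_def)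
    then have "card (seen V c v) \<le> card (insert None (Some ` {e \<in> H. v \<in> e}))"
      using g(1) by (intro card_mono) auto
    also have "\<dots> \<le> card (Some ` {e \<in> H. v \<in> e}) + 1" by (simp add: card_insert_if g(1))
    also have "\<dots> = degree H v + 1" by (simp add: card_image degree_def)
    also have "\<dots> \<le> d + 1" using H(1) by (simp add: bounded_graph_def)
    finally show "card (seen V c v) \<le> d + 1" .
  next
    fix M assume "rainbow_matching V c M"
    then have M: "pairwise disjnt M" "inj_on c M"
      by (auto simp: rainbow_matching_def matching_in_def)
    have "matching_in H (M \<inter> H)" using M(1) by (auto simp: matching_in_def pairwise_def)
    then have 1: "card (M \<inter> H) \<le> d" using H(1) by (simp add: bounded_graph_def)
    have "e = f" if "e \<in> M - H" "f \<in> M - H" for e f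
      using that M(2) by (auto simp: inj_on_def c_def)
    then have "\<exists>e. M - H \<subseteq> {e}" by blast
    then have 2: "card (M - H) \<le> 1" by (metis card_mono card_1_singleton_iff finite.simps One_nat_def)
    have "M = (M \<inter> H) \<union> (M - H)" by auto
    then have "card M \<le> card (M \<inter> H) + card (M - H)" by (metis card_Un_le)
    then show "card M \<le> d + 1" using 1 2 by linarith
  qed
  have HV: "H \<subseteq> [V]\<^bsup>2\<^esup>"
    using g(2) H(2) V(1) by (auto simp: nsets_def intro: finite_subset)
  \<comment> \<open>The strict inclusion of \<open>\<Union>H\<close> in \<open>V\<close> ensures an
    edge outside \<open>H\<close>, so that \<open>None\<close> really occurs as a color.\<close>
  obtain x where x: "x \<in> V" "x \<notin> \<Union>H" using H(2) by auto
  have "V \<noteq> {x}" using V(2) by auto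
  then obtain y where y: "y \<in> V" "y \<noteq> x" using x(1) by auto
  have xy: "{x, y} \<in> [V]\<^bsup>2\<^esup>" "{x, y} \<notin> H" using x y by (auto simp: nsets_def)
  have "c ` [V]\<^bsup>2\<^esup> = insert None (Some ` H)"
  proof
    show "c ` [V]\<^bsup>2\<^esup> \<subseteq> insert None (Some ` H)" by (auto simp: c_def)
    have "None \<in> c ` [V]\<^bsup>2\<^esup>"
      by (rule image_eqI[of _ _ "{x, y}"]) (use xy in \<open>simp_all add: c_def\<close>)
    moreover have "Some e \<in> c ` [V]\<^bsup>2\<^esup>" if "e \<in> H" for e
      by (rule image_eqI[of _ _ e]) (use that HV in \<open>auto simp: c_def\<close>)
    ultimately show "insert None (Some ` H) \<subseteq> c ` [V]\<^bsup>2\<^esup>" by auto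
  qed
  then show "card (c ` [V]\<^bsup>2\<^esup>) = card H + 1"
    using g(1) by (simp add: card_insert_if card_image)
qed

section \<open>Extremal graphs for the Chvatal--Hanson bound\<close>

lemma card_matching_le_half:
  assumes "finite A" "matching_in ([A]\<^bsup>2\<^esup>) M"
  shows "2 * card M \<le> card A"
proof -
  have "edge_graph ([A]\<^bsup>2\<^esup>)" using assms(1) by (auto simp: edge_graph_def nsets_def)
  then have "card (\<Union>M) = 2 * card M" using assms(2) by (rule card_Union_matching)
  moreover have "\<Union>M \<subseteq> A" using assms(2) by (auto simp: matching_in_def nsets_def)
  ultimately show ?thesis using card_mono[OF assms(1)] by metis
qed

lemma degree_nsets_le:
  assumes "finite A"
  shows "degree ([A]\<^bsup>2\<^esup>) v \<le> card A - 1"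
proof -
  have "edge_graph ([A]\<^bsup>2\<^esup>)" using assms(1) by (auto simp: edge_graph_def nsets_def)
  then have "degree ([A]\<^bsup>2\<^esup>) v \<le> card (\<Union>([A]\<^bsup>2\<^esup>)) - 1" by (rule degree_less_card_Union)
  moreover have "card (\<Union>([A]\<^bsup>2\<^esup>)) \<le> card A"
    by (rule card_mono[OF assms]) (auto simp: nsets_def)
  ultimately show ?thesis by linarith
qed

lemma bounded_graph_complete:
  assumes "finite A" "card A = d + 1" "even d"
  shows "bounded_graph d (d div 2) ([A]\<^bsup>2\<^esup>)"
proof -
  have "edge_graph ([A]\<^bsup>2\<^esup>)" using assms(1) by (auto simp: edge_graph_def nsets_def)
  moreover have "degree ([A]\<^bsup>2\<^esup>) v \<le> d" for v using degree_nsets_le[OF assms(1), of v] assms(2) by simp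
  moreover have "card M \<le> d div 2" if "matching_in ([A]\<^bsup>2\<^esup>) M" for M
    using card_matching_le_half[OF assms(1) that] assms(2,3) by (auto elim!: evenE)
  ultimately show ?thesis by (simp add: bounded_graph_def)
qed

text \<open>Two disjoint complete graphs on \<open>d + 1\<close> vertices; as \<open>d + 1\<close>
  is odd, each has matching number only \<open>d div 2\<close>.\<close>

lemma extremal_graph_even:
  assumes "even d"
  obtains H :: "nat set set" where "bounded_graph d d H" "card H = d * d + d" "\<Union>H \<subseteq> {..<2 * d + 2}"
proof -
  let ?A = "{..<d + 1}" and ?B = "{d + 1..<2 * d + 2}"
  let ?H = "[?A]\<^bsup>2\<^esup> \<union> [?B]\<^bsup>2\<^esup>"
  have bA: "bounded_graph d (d div 2) ([?A]\<^bsup>2\<^esup>)" by (rule bounded_graph_complete) (use assms in auto)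
  have bB: "bounded_graph d (d div 2) ([?B]\<^bsup>2\<^esup>)" by (rule bounded_graph_complete) (use assms in auto)
  have dis: "\<Union>([?A]\<^bsup>2\<^esup>) \<inter> \<Union>([?B]\<^bsup>2\<^esup>) = {}" by (fastforce simp: nsets_def)
  have "d div 2 + d div 2 = d" using assms by (auto elim!: evenE)
  then have "bounded_graph d d ?H" using bounded_graph_disjoint_union(1)[OF bA bB dis] by simp
  moreover have "card ?H = d * d + d"
  proof -
    have "card ?H = 2 * ((d + 1) choose 2)"
      using bounded_graph_disjoint_union(2)[OF bA bB dis] by (simp add: card_nsets)
    also have "\<dots> = d * d + d" using assms by (auto simp: choose_two elim!: evenE)
    finally show ?thesis .
  qed
  moreover have "\<Union>?H \<subseteq> {..<2 * d + 2}" by (fastforce simp: nsets_def)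
  ultimately show ?thesis using that by blast
qed

text \<open>The complete graph on \<open>2m + 3\<close> vertices has matching number
  \<open>m + 1\<close>, but its degrees \<open>2m + 2\<close> are one too large. So a smallest edge
  cover \<open>P\<close> is removed: \<open>m + 1\<close> disjoint pairs and one further edge for
  the odd vertex \<open>2m + 2\<close>.\<close>

lemma near_complete_graph:
  fixes m :: nat
  defines "C \<equiv> {..<2 * m + 3}"
  obtains H :: "nat set set" where "bounded_graph (2 * m + 1) (m + 1) H"
    "card H = 2 * m * m + 4 * m + 1" "\<Union>H \<subseteq> C"
proof -
  define P where "P = insert {0, 2 * m + 2} ((\<lambda>i. {2 * i, 2 * i + 1}) ` {..m})"
  define H where "H = [C]\<^bsup>2\<^esup> - P"
  have finC: "finite C" "card C = 2 * m + 3" by (auto simp: C_def)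
  have PC: "P \<subseteq> [C]\<^bsup>2\<^esup>" by (auto simp: P_def C_def nsets_def card_insert_if)
  have cardP: "card P = m + 2"
  proof -
    have "inj_on (\<lambda>i::nat. {2 * i, 2 * i + 1}) {..m}"
    proof (rule inj_onI)
      fix i j :: nat assume "{2 * i, 2 * i + 1} = {2 * j, 2 * j + 1}"
      then have "2 * i = 2 * j \<or> 2 * i = 2 * j + 1 \<and> 2 * i + 1 = 2 * j" by (auto simp: doubleton_eq_iff)
      then show "i = j" by auto
    qed
    then have "card ((\<lambda>i::nat. {2 * i, 2 * i + 1}) ` {..m}) = m + 1" by (simp add: card_image)
    moreover have "{0, 2 * m + 2} \<notin> (\<lambda>i. {2 * i, 2 * i + 1}) ` {..m}"
      by (auto simp: doubleton_eq_iff)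
    ultimately show ?thesis by (simp add: P_def)
  qed
  have finK: "finite ([C]\<^bsup>2\<^esup>)" using finC(1) by (rule finite_imp_finite_nsets)
  have gH: "edge_graph H" using finK by (auto simp: edge_graph_def H_def nsets_def)
  moreover have "degree H v \<le> 2 * m + 1" for v
  proof (cases "v \<in> C")
    case True
    have "\<exists>e\<in>P. v \<in> e"
    proof (cases "v = 2 * m + 2")
      case False
      then have "v div 2 \<in> {..m}" using True by (auto simp: C_def)
      moreover have "v \<in> {2 * (v div 2), 2 * (v div 2) + 1}" by auto
      ultimately show ?thesis
        by (intro bexI[of _ "{2 * (v div 2), 2 * (v div 2) + 1}"]) (simp_all add: P_def)
    qed (auto simp: P_def)
    then have "{e \<in> H. v \<in> e} \<subset> {e \<in> [C]\<^bsup>2\<^esup>. v \<in> e}" using PC by (auto simp: H_def)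
    then have "degree H v < degree ([C]\<^bsup>2\<^esup>) v"
      unfolding degree_def using finK by (intro psubset_card_mono) auto
    then show ?thesis using degree_nsets_le[OF finC(1), of v] finC(2) by simp
  next
    case False
    then have "{e \<in> H. v \<in> e} = {}" by (auto simp: H_def nsets_def)
    then show ?thesis unfolding degree_def by (metis card.empty le0)
  qed
  moreover have "card M \<le> m + 1" if "matching_in H M" for M
  proof -
    have "matching_in ([C]\<^bsup>2\<^esup>) M" using that by (rule matching_in_mono) (auto simp: H_def)
    then show ?thesis using card_matching_le_half[OF finC(1)] finC(2) by force
  qed
  ultimately have "bounded_graph (2 * m + 1) (m + 1) H" by (simp add: bounded_graph_def)
  moreover have "card H = 2 * m * m + 4 * m + 1"
  proof -
    have "card H = ((2 * m + 3) choose 2) - (m + 2)"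
      unfolding H_def using PC finK cardP finC(2)
      by (subst card_Diff_subset) (auto simp: card_nsets intro: finite_subset)
    also have "(2 * m + 3) choose 2 = (2 * m + 3) * (m + 1)" by (simp add: choose_two)
    finally show ?thesis by (simp add: algebra_simps)
  qed
  moreover have "\<Union>H \<subseteq> C" by (auto simp: H_def nsets_def)
  ultimately show ?thesis using that by blast
qed

text \<open>These are \<open>m\<close> disjoint stars with \<open>d\<close> edges: the centers start
  at \<open>s\<close>, and leaf number \<open>l\<close> hangs on center number
  \<open>l div d\<close>. Each edge contains a center, which bounds the matchings. The offset
  \<open>s\<close> keeps the forest apart from another graph.\<close>

lemma star_forest:
  fixes m d s :: nat
  assumes "1 \<le> d"
  obtains H :: "nat set set" where "bounded_graph d m H" "card H = m * d"
    "\<Union>H \<subseteq> {s..<s + m + m * d}"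
proof -
  define e where "e l = {s + l div d, s + m + l}" for l
  define H where "H = e ` {..<m * d}"
  have center: "l div d < m" if "l < m * d" for l using that by (simp add: less_mult_imp_div_less)
  have mem: "v \<in> e l \<longleftrightarrow> v = s + l div d \<or> v = s + m + l" for v l by (auto simp: e_def)
  have inj: "inj_on e {..<m * d}"
  proof (rule inj_onI)
    fix i j assume ij: "i \<in> {..<m * d}" "j \<in> {..<m * d}" "e i = e j"
    then have "s + m + i \<in> e j" by (metis mem)
    then have "s + m + i = s + j div d \<or> i = j" by (simp add: mem)
    then show "i = j" using center[of j] ij(2) by auto
  qed
  have "card (e l) = 2" if "l < m * d" for l using center[OF that] by (simp add: e_def card_insert_if)
  then have "edge_graph H" by (auto simp: edge_graph_def H_def)
  moreover have "degree H v \<le> d" for v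
  proof (cases "v < s + m")
    case True
    have "{e \<in> H. v \<in> e} \<subseteq> e ` {(v - s) * d..<(v - s) * d + d}"
    proof
      fix f assume "f \<in> {e \<in> H. v \<in> e}"
      then obtain l where l: "f = e l" "l < m * d" "v = s + l div d" using True by (auto simp: H_def mem)
      then have "l div d = v - s" by simp
      then have "l \<in> {(v - s) * d..<(v - s) * d + d}"
        using div_mult_mod_eq[of l d] mod_less_divisor[of d l] assms
        by (simp only: atLeastLessThan_iff) linarith
      then show "f \<in> e ` {(v - s) * d..<(v - s) * d + d}" using l by blast
    qed
    then have "degree H v \<le> card {(v - s) * d..<(v - s) * d + d}"
      unfolding degree_def by (intro surj_card_le) auto
    then show ?thesis by simp
  next
    case False
    have "{e \<in> H. v \<in> e} \<subseteq> {e (v - (s + m))}" using False center by (fastforce simp: H_def mem)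
    then have "degree H v \<le> card {e (v - (s + m))}" unfolding degree_def by (intro card_mono) auto
    then show ?thesis using assms by simp
  qed
  moreover have "card M \<le> m" if M: "matching_in H M" for M
  proof -
    have "\<forall>f. \<exists>x. f \<in> M \<longrightarrow> x \<in> f \<and> x \<in> {s..<s + m}"
    proof
      fix f
      show "\<exists>x. f \<in> M \<longrightarrow> x \<in> f \<and> x \<in> {s..<s + m}"
      proof (cases "f \<in> M")
        case True
        then obtain l where "f = e l" "l < m * d" using M by (auto simp: matching_in_def H_def)
        then show ?thesis using center[of l] by (intro exI[of _ "s + l div d"]) (auto simp: mem)
      qed simp
    qed
    then obtain x where x: "\<And>f. f \<in> M \<Longrightarrow> x f \<in> f \<and> x f \<in> {s..<s + m}" by metis
    have "inj_on x M"
    proof (rule inj_onI)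
      fix f g assume "f \<in> M" "g \<in> M" "x f = x g"
      then show "f = g" using matching_in_unique[OF M, of f g "x f"] x[of f] x[of g] by auto
    qed
    then have "card M \<le> card {s..<s + m}" by (rule card_inj_on_le) (use x in auto)
    then show ?thesis by simp
  qed
  ultimately have "bounded_graph d m H" by (simp add: bounded_graph_def)
  moreover have "card H = m * d" using card_image[OF inj] by (simp add: H_def)
  moreover have "\<Union>H \<subseteq> {s..<s + m + m * d}" using center by (fastforce simp: H_def mem)
  ultimately show ?thesis using that by blast
qed

text \<open>For \<open>d = 2m + 1\<close> the near complete graph contributes the surplus
  \<open>d div 2\<close> but uses only \<open>m + 1\<close> of the matching number; \<open>m\<close>
  stars fill the rest with \<open>d\<close> edges each.\<close>

lemma extremal_graph_odd:
  assumes "odd d"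
  obtains H :: "nat set set" where "bounded_graph d d H" "card H = d * d + d div 2"
    "\<Union>H \<subseteq> {..<d * d + 2 * d + 2}"
proof -
  obtain m where m: "d = 2 * m + 1" using assms by (auto elim: oddE)
  obtain H1 :: "nat set set" where H1: "bounded_graph d (m + 1) H1"
    "card H1 = 2 * m * m + 4 * m + 1" "\<Union>H1 \<subseteq> {..<2 * m + 3}"
    using near_complete_graph[of m] m by metis
  obtain H2 :: "nat set set" where H2: "bounded_graph d m H2" "card H2 = m * d"
    "\<Union>H2 \<subseteq> {2 * m + 3..<2 * m + 3 + m + m * d}"
    using star_forest[of d m "2 * m + 3"] m by (metis le_add2)
  have "{..<2 * m + 3} \<inter> {2 * m + 3..<2 * m + 3 + m + m * d} = {}" by auto
  then have dis: "\<Union>H1 \<inter> \<Union>H2 = {}" using H1(3) H2(3) by blast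
  have "bounded_graph d d (H1 \<union> H2)"
    using bounded_graph_disjoint_union(1)[OF H1(1) H2(1) dis] m by (simp add: mult_2)
  moreover have "card (H1 \<union> H2) = d * d + d div 2"
    using bounded_graph_disjoint_union(2)[OF H1(1) H2(1) dis] H1(2) H2(2) m by (simp add: algebra_simps)
  moreover have "\<Union>(H1 \<union> H2) \<subseteq> {..<d * d + 2 * d + 2}"
  proof -
    have "2 * m + 3 + m + m * d \<le> d * d + 2 * d + 2" using m by (simp add: algebra_simps)
    then have "{..<2 * m + 3} \<union> {2 * m + 3..<2 * m + 3 + m + m * d} \<subseteq> {..<d * d + 2 * d + 2}" by auto
    then show ?thesis using H1(3) H2(3) by blast
  qed
  ultimately show ?thesis using that by blast
qed

text \<open>This realizes the case of a one-element \<open>Q\<close> for \<open>d = 1\<close>: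
  vertex 1 misses the dominant color 1. The colors 0 and 2 occur only at vertex 1, so no matching
  contains both.\<close>

lemma three_coloring_avoids_rainbow:
  fixes n :: nat
  defines "c \<equiv> \<lambda>e :: nat set. if e = {0, 1} then 0 else if 1 \<in> e then 2 else 1 :: nat"
  assumes "3 \<le> n"
  shows "avoids_rainbow {..<n} c 2" "card (c ` [{..<n}]\<^bsup>2\<^esup>) = 3"
proof -
  have two: "card {x, y} \<le> 2" for x y :: nat by (simp add: card_insert_if)
  show "avoids_rainbow {..<n} c 2"
    unfolding avoids_rainbow_def
  proof (intro conjI ballI allI impI)
    fix v assume "v \<in> {..<n}"
    have "\<exists>x y. seen {..<n} c v \<subseteq> {x, y}"
    proof -
      consider "v = 0" | "v = 1" | "v \<noteq> 0" "v \<noteq> 1" by blast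
      then show ?thesis
      proof cases
        case 1
        then have "seen {..<n} c v \<subseteq> {0, 1}" by (auto simp: seen_def c_def)
        then show ?thesis by blast
      next
        case 2
        then have "seen {..<n} c v \<subseteq> {0, 2}" by (auto simp: seen_def c_def)
        then show ?thesis by blast
      next
        case 3
        then have "seen {..<n} c v \<subseteq> {1, 2}" by (auto simp: seen_def c_def doubleton_eq_iff)
        then show ?thesis by blast
      qed
    qed
    then show "card (seen {..<n} c v) \<le> 2" using two card_mono by (metis finite.emptyI finite.insertI le_trans)
  next
    fix M assume "rainbow_matching {..<n} c M"
    then have M: "pairwise disjnt M" "inj_on c M"
      by (auto simp: rainbow_matching_def matching_in_def)
    have "c ` M \<subseteq> {0, 1} \<or> c ` M \<subseteq> {1, 2}"
    proof (rule ccontr)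
      assume "\<not> (c ` M \<subseteq> {0, 1} \<or> c ` M \<subseteq> {1, 2})"
      then obtain e f where ef: "e \<in> M" "c e \<notin> {0, 1}" "f \<in> M" "c f \<notin> {1, 2}"
        using image_subsetI[of M c] by metis
      then have "1 \<in> e" "1 \<in> f" "e \<noteq> f" by (auto simp: c_def split: if_splits)
      then show False using M(1) ef by (auto simp: pairwise_def disjnt_def)
    qed
    then have "card (c ` M) \<le> 2" using two card_mono by (metis finite.emptyI finite.insertI le_trans)
    then show "card M \<le> 2" using card_image[OF M(2)] by simp
  qed
  have "c ` [{..<n}]\<^bsup>2\<^esup> = {0, 1, 2}"
  proof
    have "{0, 1} \<in> [{..<n}]\<^bsup>2\<^esup>" "{0, 2} \<in> [{..<n}]\<^bsup>2\<^esup>" "{1, 2} \<in> [{..<n}]\<^bsup>2\<^esup>"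
      using assms by (auto simp: nsets_def)
    moreover have "c {0, 1} = 0" "c {0, 2} = 1" "c {1, 2} = 2"
      by (auto simp: c_def doubleton_eq_iff)
    ultimately show "{0, 1, 2} \<subseteq> c ` [{..<n}]\<^bsup>2\<^esup>" by (metis image_eqI insert_subsetI empty_subsetI)
  qed (auto simp: c_def)
  then show "card (c ` [{..<n}]\<^bsup>2\<^esup>) = 3" by simp
qed

lemma anti_ramsey_value:
  fixes n d :: nat
  assumes d: "1 \<le> d" and n: "3 * (d + 1)\<^sup>2 \<le> n"
  shows "anti_ramsey n {star_graph (d + 1 + 1), matching_graph (d + 1 + 1)} =
    (if d = 1 then 3 else if even d then d * d + d + 1 else d * d + d div 2 + 1) + 1"
proof -
  define R where "R = (if d = 1 then 3 else if even d then d * d + d + 1 else d * d + d div 2 + 1)"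
  have upper: "card (c ` [{..<n}]\<^bsup>2\<^esup>) \<le> R" if "avoids_rainbow {..<n} c (d + 1)" for c :: "nat set \<Rightarrow> nat"
  proof -
    interpret rainbow_free "{..<n}" c d
      by unfold_locales (use that d n in \<open>auto simp: avoids_rainbow_def\<close>)
    show ?thesis using card_colors_bound by (simp add: R_def)
  qed
  have n': "3 * (d * d) + 6 * d + 3 \<le> n" using n by (simp add: power2_eq_square algebra_simps)
  \<comment> \<open>Confining \<open>H\<close> to the first \<open>n - 1\<close> vertices leaves one
    vertex uncovered, as the coloring requires.\<close>
  have graph: ?thesis if H: "bounded_graph d d H" "card H + 1 = R" "\<Union>H \<subseteq> {..<n - 1}" for H :: "nat set set"
  proof -
    have "{..<n - 1} \<subset> {..<n}" using n' by auto
    then have "\<Union>H \<subset> {..<n}" using H(3) by (rule subset_psubset_trans[rotated])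
    note col = avoids_rainbow_of_graph[OF H(1) this]
    have "2 \<le> card {..<n}" using n' by simp
    then show ?thesis
      unfolding R_def[symmetric] using anti_ramsey_eqI[OF col(1) _ upper] col(2) H(2) by simp
  qed
  show ?thesis
  proof (cases "d = 1")
    case True
    have "3 \<le> n" using n' by simp
    have two: "d + 1 = 2" and R: "R = 3" using True by (simp_all add: R_def)
    show ?thesis
      unfolding R_def[symmetric] R two
      by (rule anti_ramsey_eqI[OF three_coloring_avoids_rainbow[OF \<open>3 \<le> n\<close>]])
        (use upper[unfolded R two] in blast)
  next
    case d1: False
    show ?thesis
    proof (cases "even d")
      case True
      obtain H :: "nat set set" where H: "bounded_graph d d H" "card H = d * d + d" "\<Union>H \<subseteq> {..<2 * d + 2}"
        using extremal_graph_even[OF True] .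
      have "{..<2 * d + 2} \<subseteq> {..<n - 1}" using n' by auto
      with H(3) have "\<Union>H \<subseteq> {..<n - 1}" by (rule subset_trans)
      then show ?thesis by (intro graph[OF H(1)]) (use H(2) True d1 in \<open>auto simp: R_def\<close>)
    next
      case False
      obtain H :: "nat set set" where H: "bounded_graph d d H" "card H = d * d + d div 2"
        "\<Union>H \<subseteq> {..<d * d + 2 * d + 2}"
        using extremal_graph_odd[OF False] .
      have "{..<d * d + 2 * d + 2} \<subseteq> {..<n - 1}" using n' d by auto
      with H(3) have "\<Union>H \<subseteq> {..<n - 1}" by (rule subset_trans)
      then show ?thesis by (intro graph[OF H(1)]) (use H(2) False d1 in \<open>auto simp: R_def\<close>)
    qed
  qed
qed

theorem theorem1p2:
  fixes n k :: nat
  assumes "k \<ge> 2" and "n \<ge> 3 * k\<^sup>2"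
  shows "real (anti_ramsey n {star_graph (k + 1), matching_graph (k + 1)}) =
    (if k = 2 then 4
     else if odd k then (real k)\<^sup>2 - real k + 2
     else (real k)\<^sup>2 - 3 / 2 * real k + 2)"
proof -
  obtain d where d: "k = d + 1" "1 \<le> d" using assms(1) by (metis add.commute le_Suc_ex nat_1_add_1 le_add1 add.assoc)
  have value_eq: "anti_ramsey n {star_graph (k + 1), matching_graph (k + 1)} =
      (if d = 1 then 3 else if even d then d * d + d + 1 else d * d + d div 2 + 1) + 1"
    using anti_ramsey_value[OF d(2)] assms(2) d(1) by simp
  show ?thesis
  \<comment> \<open>Parities swap under \<open>k = d + 1\<close>: for even \<open>d\<close> the
    value is \<open>d\<^sup>2 + d + 2 = k\<^sup>2 - k + 2\<close>, for odd \<open>d \<ge> 3\<close>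
    it is \<open>d\<^sup>2 + (d - 1)/2 + 2 = k\<^sup>2 - 3k/2 + 2\<close>.\<close>
  proof (cases "even d")
    case True
    then show ?thesis using value_eq d by (auto simp: power2_eq_square algebra_simps)
  next
    case False
    then obtain m where "d = 2 * m + 1" by (auto elim: oddE)
    then show ?thesis using value_eq d by (auto simp: power2_eq_square algebra_simps)
  qed
qed

end
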